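(* Let $\mathcal{P}$ be a nice Roman domination property and let $\mathcal{G}$ be a class of graphs. If there exists an algorithm that, for every $G=(V,E)\in\mathcal{G}$ and every $A\subseteq V$, enumerates all elements of $C_{\mathcal{P},G}[A]$ in output-polynomial time (resp. with polynomial delay), then there exists an algorithm that, for every $G\in\mathcal{G}$, enumerates all minimal functions with property $\mathcal{P}$ on $G$ in output-polynomial time (resp. with polynomial delay).
   Context: Graphs are finite, simple and undirected. For a graph $G=(V,E)$ and $v\in V$, $N(v)$ is the open neighborhood, $N[v]=N(v)\cup\{v\}$, and for $A\subseteq V$, $N(A)=\bigcup_{v\in A}N(v)$, $N[A]=\bigcup_{v\in A}N[v]$. For $A\subseteq V$ and $v\in A$, the private neighborhood is $P_{G,A}(v)=N[v]\setminus N[A\setminus\{v\}]$ (neighborhoods taken in $G$). For $f:V\to\{0,1,2\}$ let $V_i(f)=\{v\in V: f(v)=i\}$. Functions are compared pointwise: $f\le g$ iff $f(v)\le g(v)$ for all $v$. $\chi_S$ denotes the characteristic function of $S$. A Roman dominating function (Rdf) on $G$ is an $f:V\to\{0,1,2\}$ such that every $v\in V_0(f)$ has a neighbor in $V_2(f)$. A property $\mathcal{P}$ assigns to each graph $G$ a set of functions $V\to\{0,1,2\}$ (those "having property $\mathcal{P}$"); $f$ is minimal with property $\mathcal{P}$ if $f$ has $\mathcal{P}$ and no $g\le f$ with $g\ne f$ has $\mathcal{P}$. A property $\mathcal{P}$ is a nice Roman domination property if for every graph $G=(V,E)$ and every $f$ with property $\mathcal{P}$: (1) $f$ is an Rdf;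 (2) for all $v\in V_0(f)$, $f+\chi_{\{v\}}$ has property $\mathcal{P}$; (3) for all $v\in V_2(f)$, $f-\chi_{\{v\}}$ has property $\mathcal{P}$ if and only if $P_{G[V\setminus V_1(f)],V_2(f)}(v)\subseteq\{v\}$. For such $\mathcal{P}$, a graph $G$ and $A\subseteq V$, $C_{\mathcal{P},G}[A]$ is the set of all functions $f:V\to\{0,1,2\}$ that are minimal with property $\mathcal{P}$ on $G$ and satisfy $V_2(f)=A$. An enumeration algorithm runs in output-polynomial time if its running time is bounded by a polynomial in the input size and the number of outputs; it has polynomial delay if the time before the first output, between consecutive outputs, and after the last output is bounded by a polynomial in the input size. Outputs are produced without repetition. *)

theory Defs
  imports "HOL-Library.FuncSet" "HOL-Library.Indicator_Function"
    "HOL-Computational_Algebra.Polynomial"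
begin

section \<open>Finite simple undirected graphs\<close>

record 'v ugraph =
  verts :: "'v set"
  edges :: "'v set set"

definition simple_graph :: "'v ugraph \<Rightarrow> bool" where
  "simple_graph G \<longleftrightarrow>
     finite (verts G) \<and> (\<forall>e\<in>edges G. e \<subseteq> verts G \<and> card e = 2)"

definition induced :: "'v ugraph \<Rightarrow> 'v set \<Rightarrow> 'v ugraph" where
  "induced G U = \<lparr>verts = verts G \<inter> U, edges = {e \<in> edges G. e \<subseteq> U}\<rparr>"

definition nbh :: "'v ugraph \<Rightarrow> 'v \<Rightarrow> 'v set" where
  "nbh G v = {u. {v, u} \<in> edges G}"

definition cnbh :: "'v ugraph \<Rightarrow> 'v \<Rightarrow> 'v set" where
  "cnbh G v = nbh G v \<union> {v}"

definition private_nbh :: "'v ugraph \<Rightarrow> 'v set \<Rightarrow> 'v \<Rightarrow> 'v set" where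
  "private_nbh G A v = cnbh G v - (\<Union>w \<in> A - {v}. cnbh G w)"


section \<open>Roman domination properties\<close>

text \<open>
  A function from the vertex set to $\{0,1,2\}$ is an element of the extensional
  function space, so that equality in HOL is equality on the vertex set.
\<close>

definition labellings :: "'v ugraph \<Rightarrow> ('v \<Rightarrow> nat) set" where
  "labellings G = verts G \<rightarrow>\<^sub>E {0, 1, 2}"

definition level :: "'v ugraph \<Rightarrow> nat \<Rightarrow> ('v \<Rightarrow> nat) \<Rightarrow> 'v set" where
  "level G i f = {v \<in> verts G. f v = i}"

definition raise_at :: "'v ugraph \<Rightarrow> ('v \<Rightarrow> nat) \<Rightarrow> 'v \<Rightarrow> 'v \<Rightarrow> nat" where
  "raise_at G f v = (\<lambda>u \<in> verts G. f u + indicator {v} u)"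

definition lower_at :: "'v ugraph \<Rightarrow> ('v \<Rightarrow> nat) \<Rightarrow> 'v \<Rightarrow> 'v \<Rightarrow> nat" where
  "lower_at G f v = (\<lambda>u \<in> verts G. f u - indicator {v} u)"

definition roman_dominating :: "'v ugraph \<Rightarrow> ('v \<Rightarrow> nat) \<Rightarrow> bool" where
  "roman_dominating G f \<longleftrightarrow>
     f \<in> labellings G \<and> (\<forall>v \<in> level G 0 f. \<exists>u \<in> nbh G v. u \<in> level G 2 f)"

type_synonym 'v property = "'v ugraph \<Rightarrow> ('v \<Rightarrow> nat) set"

definition labelling_property :: "'v property \<Rightarrow> bool" where
  "labelling_property P \<longleftrightarrow> (\<forall>G. simple_graph G \<longrightarrow> P G \<subseteq> labellings G)"

definition nice_roman_property :: "'v property \<Rightarrow> bool" where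
  "nice_roman_property P \<longleftrightarrow>
     (\<forall>G. simple_graph G \<longrightarrow> (\<forall>f \<in> P G.
        roman_dominating G f \<and>
        (\<forall>v \<in> level G 0 f. raise_at G f v \<in> P G) \<and>
        (\<forall>v \<in> level G 2 f.
           lower_at G f v \<in> P G \<longleftrightarrow>
           private_nbh (induced G (verts G - level G 1 f)) (level G 2 f) v \<subseteq> {v})))"

definition minimal_labellings :: "'v property \<Rightarrow> 'v ugraph \<Rightarrow> ('v \<Rightarrow> nat) set" where
  "minimal_labellings P G =
     {f \<in> P G. \<not> (\<exists>g \<in> P G. (\<forall>v \<in> verts G. g v \<le> f v) \<and> g \<noteq> f)}"

definition minimal_with_twos :: "'v property \<Rightarrow> 'v ugraph \<Rightarrow> 'v set \<Rightarrow> ('v \<Rightarrow> nat) set" where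
  "minimal_with_twos P G A = {f \<in> minimal_labellings P G. level G 2 f = A}"


section \<open>Algorithms\<close>

text \<open>
  Algorithms are programs of the WHILE language over binary trees (N. D. Jones,
  \<^emph>\<open>Computability and Complexity from a Programming Perspective\<close>), extended by an
  output command.  Trees are only inspected cell by cell (there is no test for equality
  of trees), so every elementary operation is a constant number of pointer operations,
  and polynomial time in this language is polynomial time on Turing machines and RAMs.
\<close>

datatype sexp = Nl | Cs sexp sexp

fun head :: "sexp \<Rightarrow> sexp" where
  "head Nl = Nl"
| "head (Cs a b) = a"

fun tail :: "sexp \<Rightarrow> sexp" where
  "tail Nl = Nl"
| "tail (Cs a b) = b"

type_synonym store = "nat \<Rightarrow> sexp"

datatype expr = Var nat | NilE | ConsE expr expr | HeadE expr | TailE expr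

fun eval :: "expr \<Rightarrow> store \<Rightarrow> sexp" where
  "eval (Var x) s = s x"
| "eval NilE s = Nl"
| "eval (ConsE a b) s = Cs (eval a s) (eval b s)"
| "eval (HeadE a) s = head (eval a s)"
| "eval (TailE a) s = tail (eval a s)"

fun expr_cost :: "expr \<Rightarrow> nat" where
  "expr_cost (Var x) = 1"
| "expr_cost NilE = 1"
| "expr_cost (ConsE a b) = 1 + expr_cost a + expr_cost b"
| "expr_cost (HeadE a) = 1 + expr_cost a"
| "expr_cost (TailE a) = 1 + expr_cost a"

datatype prog =
    Skip
  | Assign nat expr
  | Seq prog prog
  | If expr prog prog
  | While expr prog
  | Output expr

text \<open>
  The trace of a run lists its time steps and its outputs in chronological order.
  Writing an output additionally takes time proportional to its size
  (\<^term>\<open>size d\<close> is the number of cells of the tree \<^term>\<open>d\<close>).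
\<close>

datatype event = Tick | Emit sexp

abbreviation ticks :: "nat \<Rightarrow> event list" where
  "ticks k \<equiv> replicate k Tick"

inductive exec :: "prog \<Rightarrow> store \<Rightarrow> event list \<Rightarrow> store \<Rightarrow> bool" where
  Skip: "exec Skip s (ticks 1) s"
| Assign: "exec (Assign x e) s (ticks (1 + expr_cost e)) (s(x := eval e s))"
| Seq: "exec c s t s' \<Longrightarrow> exec d s' t' s'' \<Longrightarrow> exec (Seq c d) s (t @ t') s''"
| IfTrue: "eval e s \<noteq> Nl \<Longrightarrow> exec c s t s' \<Longrightarrow>
    exec (If e c d) s (ticks (1 + expr_cost e) @ t) s'"
| IfFalse: "eval e s = Nl \<Longrightarrow> exec d s t s' \<Longrightarrow>
    exec (If e c d) s (ticks (1 + expr_cost e) @ t) s'"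
| WhileFalse: "eval e s = Nl \<Longrightarrow> exec (While e c) s (ticks (1 + expr_cost e)) s"
| WhileTrue: "eval e s \<noteq> Nl \<Longrightarrow> exec c s t s' \<Longrightarrow> exec (While e c) s' t' s'' \<Longrightarrow>
    exec (While e c) s (ticks (1 + expr_cost e) @ t @ t') s''"
| Output: "exec (Output e) s
    (ticks (1 + expr_cost e + size (eval e s)) @ [Emit (eval e s)]) s"

lemma exec_deterministic:
  "exec c s t s1 \<Longrightarrow> exec c s t' s2 \<Longrightarrow> t' = t \<and> s2 = s1"
proof (induction arbitrary: t' s2 rule: exec.induct)
  case Skip
  then show ?case by (auto elim: exec.cases)
next
  case Assign
  then show ?case by (auto elim: exec.cases)
next
  case (Seq c s t s' d t1 s'')
  from Seq.prems obtain u u' r where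
    "exec c s u r" "exec d r u' s2" "t' = u @ u'"
    by (auto elim: exec.cases)
  with Seq.IH show ?case by blast
next
  case (IfTrue e s c t s' d)
  from IfTrue.prems IfTrue.hyps obtain u where
    "exec c s u s2" "t' = ticks (1 + expr_cost e) @ u"
    by cases auto
  with IfTrue.IH show ?case by blast
next
  case (IfFalse e s d t s' c)
  from IfFalse.prems IfFalse.hyps obtain u where
    "exec d s u s2" "t' = ticks (1 + expr_cost e) @ u"
    by cases auto
  with IfFalse.IH show ?case by blast
next
  case (WhileFalse e s c)
  from WhileFalse.prems WhileFalse.hyps show ?case by cases auto
next
  case (WhileTrue e s c t s' t1 s'')
  from WhileTrue.prems WhileTrue.hyps obtain u u' r where
    "exec c s u r" "exec (While e c) r u' s2" "t' = ticks (1 + expr_cost e) @ u @ u'"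
    by cases auto
  with WhileTrue.IH show ?case by blast
next
  case Output
  then show ?case by (auto elim: exec.cases)
qed

text \<open>The input is passed in variable 0; all other variables are initially empty.\<close>

definition run :: "prog \<Rightarrow> sexp \<Rightarrow> event list \<Rightarrow> bool" where
  "run c d t \<longleftrightarrow> (\<exists>s. exec c ((\<lambda>_. Nl)(0 := d)) t s)"

definition run_time :: "event list \<Rightarrow> nat" where
  "run_time t = count_list t Tick"

fun outputs :: "event list \<Rightarrow> sexp list" where
  "outputs [] = []"
| "outputs (Tick # t) = outputs t"
| "outputs (Emit d # t) = d # outputs t"

text \<open>
  Blocks of consecutive ticks are the time spans before the first output, between
  consecutive outputs, and after the last output.
\<close>

definition delay_at_most :: "event list \<Rightarrow> nat \<Rightarrow> bool" where
  "delay_at_most t b \<longleftrightarrow> (\<forall>t1 k t2. t = t1 @ ticks k @ t2 \<longrightarrow> k \<le> b)"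

text \<open>
  In the next two definitions, \<^term>\<open>I\<close> is the set of instances, \<^term>\<open>enc\<close> their encoding as
  program input, and \<^term>\<open>sol x\<close> the set of (encoded) solutions of the instance \<^term>\<open>x\<close>.
  A polynomial in two variables is a polynomial with polynomial coefficients; it is
  evaluated at $(n, m)$ by \<^term>\<open>poly (poly p [:m:]) n\<close>.
\<close>

definition enumerates_output_poly ::
  "prog \<Rightarrow> 'i set \<Rightarrow> ('i \<Rightarrow> sexp) \<Rightarrow> ('i \<Rightarrow> sexp set) \<Rightarrow> bool" where
  "enumerates_output_poly c I enc sol \<longleftrightarrow>
     (\<exists>p :: nat poly poly. \<forall>x \<in> I. \<exists>t.
        run c (enc x) t \<and> distinct (outputs t) \<and> set (outputs t) = sol x \<and>
        run_time t \<le> poly (poly p [:length (outputs t):]) (size (enc x)))"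

definition enumerates_poly_delay ::
  "prog \<Rightarrow> 'i set \<Rightarrow> ('i \<Rightarrow> sexp) \<Rightarrow> ('i \<Rightarrow> sexp set) \<Rightarrow> bool" where
  "enumerates_poly_delay c I enc sol \<longleftrightarrow>
     (\<exists>p :: nat poly. \<forall>x \<in> I. \<exists>t.
        run c (enc x) t \<and> distinct (outputs t) \<and> set (outputs t) = sol x \<and>
        delay_at_most t (poly p (size (enc x))))"


section \<open>Encodings\<close>

text \<open>
  Graphs given to an algorithm have natural numbers as vertices, written in binary (least
  significant bit first).  A graph is encoded by its adjacency lists, in increasing
  order of the vertices; vertex sets and labellings are encoded by the list of their values in
  the same order.
\<close>

fun enc_list :: "sexp list \<Rightarrow> sexp" where
  "enc_list [] = Nl"
| "enc_list (d # ds) = Cs d (enc_list ds)"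

definition enc_bool :: "bool \<Rightarrow> sexp" where
  "enc_bool b = (if b then Cs Nl Nl else Nl)"

fun enc_nat :: "nat \<Rightarrow> sexp" where
  "enc_nat n = (if n = 0 then Nl else Cs (enc_bool (odd n)) (enc_nat (n div 2)))"

declare enc_nat.simps [simp del]

definition vertex_list :: "nat ugraph \<Rightarrow> nat list" where
  "vertex_list G = sorted_list_of_set (verts G)"

definition enc_graph :: "nat ugraph \<Rightarrow> sexp" where
  "enc_graph G = enc_list (map (\<lambda>v.
     Cs (enc_nat v) (enc_list (map enc_nat (sorted_list_of_set (nbh G v))))) (vertex_list G))"

definition enc_set :: "nat ugraph \<Rightarrow> nat set \<Rightarrow> sexp" where
  "enc_set G A = enc_list (map (\<lambda>v. enc_bool (v \<in> A)) (vertex_list G))"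

definition enc_labelling :: "nat ugraph \<Rightarrow> (nat \<Rightarrow> nat) \<Rightarrow> sexp" where
  "enc_labelling G f = enc_list (map (\<lambda>v. enc_nat (f v)) (vertex_list G))"

lemma enc_list_inject: "enc_list xs = enc_list ys \<longleftrightarrow> xs = ys"
proof (induction xs arbitrary: ys)
  case Nil
  then show ?case by (cases ys) auto
next
  case (Cons x xs)
  then show ?case by (cases ys) auto
qed

lemma enc_nat_inject: "enc_nat m = enc_nat n \<longleftrightarrow> m = n"
proof (induction m arbitrary: n rule: less_induct)
  case (less m)
  show ?case
  proof
    assume eq: "enc_nat m = enc_nat n"
    show "m = n"
    proof (cases "m = 0 \<or> n = 0")
      case True
      with eq show ?thesis
        by (auto simp: enc_nat.simps[of m] enc_nat.simps[of n] split: if_splits)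
    next
      case False
      with eq have "odd m = odd n" "enc_nat (m div 2) = enc_nat (n div 2)"
        by (auto simp: enc_nat.simps[of m] enc_nat.simps[of n] enc_bool_def split: if_splits)
      moreover from False have "m div 2 < m" by simp
      ultimately have "odd m = odd n" "m div 2 = n div 2"
        using less.IH by blast+
      then show ?thesis by presburger
    qed
  qed simp
qed

lemma inj_on_enc_labelling:
  assumes "simple_graph G"
  shows "inj_on (enc_labelling G) (labellings G)"
proof (rule inj_onI)
  fix f g
  assume f: "f \<in> labellings G" and g: "g \<in> labellings G"
    and eq: "enc_labelling G f = enc_labelling G g"
  have "set (vertex_list G) = verts G"
    using assms by (simp add: vertex_list_def simple_graph_def)
  with eq have "f v = g v" if "v \<in> verts G" for v
    using that by (auto simp: enc_labelling_def enc_list_inject enc_nat_inject)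
  with f g show "f = g"
    unfolding labellings_def by (blast intro: PiE_ext)
qed

end

theory Submission imports Defs begin

text \<open>
  The sets \<open>A\<close> for which some minimal function has \<open>V\<^sub>2 = A\<close> are closed under subsets: given a
  minimal \<open>f\<close> and \<open>v \<in> V\<^sub>2(f)\<close>, raise the private neighbours of \<open>v\<close> of value 0 to 1, lower \<open>v\<close>
  to 1, and minimise further without changing \<open>V\<^sub>2\<close>; the remaining vertices of value 2 keep their
  private neighbours of value 0, so the result is minimal.  Hence a depth-first search over the
  subsets of \<open>V\<close> can run the given algorithm on each set it meets and prune as soon as there is no
  output.  Different sets give disjoint outputs.  Every set with outputs has at most \<open>|V|\<close>
  fruitless children, and the search meets \<open>O(|V|\<^sup>2)\<close> fruitless sets between two fruitful ones.
\<close>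

section \<open>Heredity of the sets of vertices of value 2\<close>

text \<open>Members of a nice property arise only through its conditions (2) and (3), and (3) lets a
  2 be lowered only when it has no private neighbour of value 0 left. This is the reason for raising
  before lowering. There is no separate test for the existence of solutions, so one and the same
  call has to emit the solutions of a set and to report, by a flag, whether there were any. No set
  is called twice: the child that excludes a vertex denotes the same set as its parent, so only the
  including child costs a call. Fruitless calls are cheap in both versions: with polynomial delay
  the whole run is a single span without output, and with output-polynomial time the bound is taken
  at 0 outputs. What remains is to control how many of them occur in a row, and how spans that cross
  the borders of calls add up.\<close>

definition zero_private :: "'v ugraph \<Rightarrow> ('v \<Rightarrow> nat) \<Rightarrow> 'v \<Rightarrow> 'v set" where
  "zero_private G f v =
     {u \<in> level G 0 f. {v, u} \<in> edges G \<and> (\<forall>w \<in> level G 2 f - {v}. {w, u} \<notin> edges G)}"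

lemma labelling_cases:
  assumes "f \<in> labellings G" "u \<in> verts G"
  shows "f u = 0 \<or> f u = 1 \<or> f u = 2"
  using assms by (auto simp: labellings_def PiE_iff)

text \<open>Vertices of value 1 are missing from the induced graph, and a vertex of value 2 other
  than \<open>v\<close> lies in its own closed neighbourhood. So the private neighbours of
  \<open>v\<close> besides \<open>v\<close> itself are exactly those of value 0.\<close>

lemma private_nbh_subset_iff_zero_private:
  assumes f: "f \<in> labellings G" and v: "v \<in> level G 2 f"
  shows "private_nbh (induced G (verts G - level G 1 f)) (level G 2 f) v \<subseteq> {v}
           \<longleftrightarrow> zero_private G f v = {}"
proof -
  have "private_nbh (induced G (verts G - level G 1 f)) (level G 2 f) v - {v} = zero_private G f v"
  proof (intro set_eqI iffI)
    fix u assume u: "u \<in> private_nbh (induced G (verts G - level G 1 f)) (level G 2 f) v - {v}"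
    then have e: "{v, u} \<in> edges G" "u \<in> verts G" "u \<notin> level G 1 f" "u \<notin> level G 2 f"
      by (auto simp: private_nbh_def cnbh_def nbh_def induced_def)
    then have "u \<in> level G 0 f"
      using labelling_cases[OF f] by (auto simp: level_def)
    moreover have "{w, u} \<notin> edges G" if "w \<in> level G 2 f - {v}" for w
      using u that e by (auto simp: private_nbh_def cnbh_def nbh_def induced_def level_def)
    ultimately show "u \<in> zero_private G f v"
      using e by (simp add: zero_private_def)
  next
    fix u assume "u \<in> zero_private G f v"
    with v show "u \<in> private_nbh (induced G (verts G - level G 1 f)) (level G 2 f) v - {v}"
      by (auto simp: zero_private_def private_nbh_def cnbh_def nbh_def induced_def level_def)
  qed
  then show ?thesis by auto
qed

locale nice_property_on =
  fixes P :: "'v property" and G :: "'v ugraph"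
  assumes simple: "simple_graph G"
    and labelling: "labelling_property P"
    and nice: "nice_roman_property P"
begin

lemma finite_verts: "finite (verts G)"
  using simple by (simp add: simple_graph_def)

lemma in_labellings: "f \<in> P G \<Longrightarrow> f \<in> labellings G"
  using labelling simple by (auto simp: labelling_property_def)

lemma minimal_in_labellings: "minimal_labellings P G \<subseteq> labellings G"
  using in_labellings by (auto simp: minimal_labellings_def)

lemma dominated:
  assumes "f \<in> P G" "u \<in> verts G" "f u = 0"
  obtains w where "{u, w} \<in> edges G" "w \<in> level G 2 f"
proof -
  have "\<exists>w \<in> nbh G u. w \<in> level G 2 f"
    using nice simple assms
    by (auto simp: nice_roman_property_def roman_dominating_def level_def)
  then show ?thesis using that by (auto simp: nbh_def)
qed

lemma lower_iff:
  assumes "f \<in> P G" "v \<in> level G 2 f"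
  shows "lower_at G f v \<in> P G \<longleftrightarrow> zero_private G f v = {}"
  using assms nice simple private_nbh_subset_iff_zero_private[OF in_labellings[OF assms(1)] assms(2)]
  unfolding nice_roman_property_def by blast

lemma raise_set:
  assumes "f \<in> P G" "X \<subseteq> level G 0 f"
  shows "(\<lambda>u \<in> verts G. if u \<in> X then 1 else f u) \<in> P G"
proof -
  have "finite X"
    using assms(2) finite_verts by (auto simp: level_def intro: finite_subset)
  then show ?thesis
    using assms(2)
  proof (induction X rule: finite_induct)
    case empty
    have "(\<lambda>u \<in> verts G. f u) = f"
      using in_labellings[OF assms(1)] by (simp add: labellings_def PiE_def extensional_restrict)
    then show ?case using assms(1) by simp
  next
    case (insert x X)
    let ?g = "\<lambda>u \<in> verts G. if u \<in> X then 1 else f u"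
    have x: "x \<in> verts G" "f x = 0" using insert.prems by (auto simp: level_def)
    have "?g \<in> P G" using insert.IH insert.prems by blast
    moreover have "x \<in> level G 0 ?g" using x insert.hyps by (auto simp: level_def)
    ultimately have "raise_at G ?g x \<in> P G"
      using nice simple unfolding nice_roman_property_def by blast
    moreover have "raise_at G ?g x = (\<lambda>u \<in> verts G. if u \<in> insert x X then 1 else f u)"
      using x insert.hyps by (auto simp: raise_at_def fun_eq_iff indicator_def)
    ultimately show ?case by (simp only:)
  qed
qed

text \<open>Otherwise condition (3) would permit lowering \<open>v\<close>, against
  minimality.\<close>

lemma minimal_zero_private:
  assumes "f \<in> minimal_labellings P G" "v \<in> level G 2 f"
  shows "zero_private G f v \<noteq> {}"
proof
  assume "zero_private G f v = {}"
  with assms have "lower_at G f v \<in> P G" using lower_iff by (auto simp: minimal_labellings_def)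
  moreover have "\<forall>u \<in> verts G. lower_at G f v u \<le> f u" by (simp add: lower_at_def)
  moreover have "lower_at G f v v \<noteq> f v" using assms(2) by (auto simp: lower_at_def level_def)
  ultimately show False using assms(1) unfolding minimal_labellings_def by auto
qed

text \<open>A member below \<open>f\<close> keeps the private zeros of \<open>f\<close> at 0, so
  giving up the 2 at \<open>v\<close> would leave such a vertex undominated. Minimality thus only
  has to be secured among functions with the same vertices of value 2, and there a least sum of
  values suffices.\<close>

lemma ex_minimal_with_twos:
  assumes f: "f \<in> P G" and pr: "\<And>v. v \<in> level G 2 f \<Longrightarrow> zero_private G f v \<noteq> {}"
  shows "minimal_with_twos P G (level G 2 f) \<noteq> {}"
proof -
  let ?Q = "\<lambda>g. g \<in> P G \<and> (\<forall>u \<in> verts G. g u \<le> f u) \<and> level G 2 g = level G 2 f"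
  have "?Q f" using f by simp
  then obtain g where g: "?Q g" and least: "\<And>h. ?Q h \<Longrightarrow> sum g (verts G) \<le> sum h (verts G)"
    using ex_has_least_nat[of ?Q f "\<lambda>g. sum g (verts G)"] by blast
  have "h = g" if h: "h \<in> P G" and le: "\<forall>u \<in> verts G. h u \<le> g u" for h
  proof (cases "level G 2 h = level G 2 f")
    case True
    then have "?Q h" using h le g by (metis le_trans)
    then have "sum g (verts G) \<le> sum h (verts G)" by (rule least)
    then have "\<forall>u \<in> verts G. h u = g u"
      using le finite_verts by (metis leD le_neq_implies_less sum_strict_mono_ex1)
    moreover have "h \<in> labellings G" "g \<in> labellings G" using h g in_labellings by auto
    ultimately show ?thesis unfolding labellings_def by (blast intro: PiE_ext)
  next
    case False
    have sub: "level G 2 h \<subseteq> level G 2 f"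
    proof
      fix u assume u: "u \<in> level G 2 h"
      then have "u \<in> verts G" "2 \<le> g u" using le by (auto simp: level_def)
      then have "u \<in> level G 2 g" using labelling_cases[of g G u] g in_labellings by (auto simp: level_def)
      then show "u \<in> level G 2 f" using g by simp
    qed
    with False obtain v where v: "v \<in> level G 2 f" "v \<notin> level G 2 h" by blast
    then obtain u where u: "u \<in> zero_private G f v" using pr by blast
    then have "u \<in> verts G" "f u = 0" by (auto simp: zero_private_def level_def)
    then have "h u = 0" using le g by (metis le_zero_eq)
    with h \<open>u \<in> verts G\<close> obtain w where "{u, w} \<in> edges G" "w \<in> level G 2 h"
      by (rule dominated)
    then have False using sub v u by (auto simp: zero_private_def insert_commute)
    then show ?thesis ..
  qed
  then have "g \<in> minimal_with_twos P G (level G 2 f)"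
    using g unfolding minimal_with_twos_def minimal_labellings_def by blast
  then show ?thesis by blast
qed

lemma minimal_with_twos_remove:
  assumes "minimal_with_twos P G A \<noteq> {}"
  shows "minimal_with_twos P G (A - {v}) \<noteq> {}"
proof (cases "v \<in> A")
  case False
  then show ?thesis using assms by simp
next
  case True
  obtain f where f: "f \<in> minimal_labellings P G" and A: "level G 2 f = A"
    using assms by (auto simp: minimal_with_twos_def)
  have fP: "f \<in> P G" using f by (simp add: minimal_labellings_def)
  have v: "v \<in> verts G" "f v = 2" using True A by (auto simp: level_def)
  \<comment> \<open>Raising the zero-valued private neighbours of \<open>v\<close> makes the value 2 at \<open>v\<close> superfluous,
    and leaves the private neighbours of the other vertices untouched.\<close>
  define X where "X = zero_private G f v"
  define h where "h = (\<lambda>u \<in> verts G. if u \<in> X then 1 else f u)"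
  have X: "X \<subseteq> level G 0 f" by (auto simp: X_def zero_private_def)
  then have "h \<in> P G" unfolding h_def by (rule raise_set[OF fP])
  have h2: "level G 2 h = A" using X A by (auto simp: level_def h_def)
  have h0: "level G 0 h = level G 0 f - X" by (auto simp: level_def h_def)
  have "zero_private G h v = {}"
    unfolding zero_private_def h2 h0 using A by (auto simp: X_def zero_private_def)
  with \<open>h \<in> P G\<close> have low: "lower_at G h v \<in> P G"
    using lower_iff h2 True by simp
  have vX: "v \<notin> X" using X v by (auto simp: level_def)
  have l2: "level G 2 (lower_at G h v) = A - {v}"
  proof -
    \<comment> \<open>A value 3 would be lowered to 2.\<close>
    have "h u \<noteq> 3" if "u \<in> verts G" for u
      using labelling_cases[OF in_labellings[OF \<open>h \<in> P G\<close>] that] by auto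
    then show ?thesis
      unfolding h2[symmetric] using v vX by (auto simp: level_def lower_at_def h_def indicator_def)
  qed
  have l0: "level G 0 f - X \<subseteq> level G 0 (lower_at G h v)"
    using v by (auto simp: level_def lower_at_def h_def)
  have "zero_private G (lower_at G h v) w \<noteq> {}" if w: "w \<in> A - {v}" for w
  proof -
    obtain u where u: "u \<in> zero_private G f w"
      using minimal_zero_private[OF f] w A by blast
    \<comment> \<open>A zero that is private to \<open>w\<close> is not adjacent to
      \<open>v\<close>, hence is not raised.\<close>
    then have "{v, u} \<notin> edges G" using w True A by (auto simp: zero_private_def)
    then have "u \<notin> X" by (auto simp: X_def zero_private_def)
    then have "u \<in> zero_private G (lower_at G h v) w"
      using u l0 A unfolding zero_private_def l2 by auto
    then show ?thesis by blast
  qed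
  then show ?thesis using ex_minimal_with_twos[OF low] unfolding l2 by blast
qed

lemma minimal_with_twos_subset:
  assumes "minimal_with_twos P G A \<noteq> {}" "B \<subseteq> A"
  shows "minimal_with_twos P G B \<noteq> {}"
proof -
  have "A \<subseteq> verts G" using assms(1) by (auto simp: minimal_with_twos_def level_def)
  then have "finite (A - B)" using finite_verts by (auto intro: finite_subset)
  \<comment> \<open>\<open>A - (A - B)\<close> is the intersection of \<open>A\<close> and
    \<open>B\<close>; in this form the induction on the set of removed elements carries no side
    condition on \<open>B\<close>.\<close>
  then have "minimal_with_twos P G (A - (A - B)) \<noteq> {}"
  proof (induction "A - B" arbitrary: B rule: finite_psubset_induct)
    case (psubset B)
    show ?case
    proof (cases "A - B = {}")
      case True
      then have "A - (A - B) = A" by blast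
      then show ?thesis using assms(1) by simp
    next
      case False
      then obtain v where v: "v \<in> A" "v \<notin> B" by blast
      have "minimal_with_twos P G (A - (A - insert v B)) \<noteq> {}"
        using v by (intro psubset.hyps) auto
      then have "minimal_with_twos P G (A - (A - insert v B) - {v}) \<noteq> {}"
        by (rule minimal_with_twos_remove)
      moreover have "A - (A - insert v B) - {v} = A - (A - B)" using v by blast
      ultimately show ?thesis by simp
    qed
  qed
  then show ?thesis using assms(2) by (simp add: double_diff)
qed

end

section \<open>Running an algorithm as a subroutine\<close>

fun expr_vars :: "expr \<Rightarrow> nat set" where
  "expr_vars (Var x) = {x}"
| "expr_vars NilE = {}"
| "expr_vars (ConsE a b) = expr_vars a \<union> expr_vars b"
| "expr_vars (HeadE a) = expr_vars a"
| "expr_vars (TailE a) = expr_vars a"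

fun prog_vars :: "prog \<Rightarrow> nat set" where
  "prog_vars Skip = {}"
| "prog_vars (Assign x e) = insert x (expr_vars e)"
| "prog_vars (Seq c d) = prog_vars c \<union> prog_vars d"
| "prog_vars (If e c d) = expr_vars e \<union> prog_vars c \<union> prog_vars d"
| "prog_vars (While e c) = expr_vars e \<union> prog_vars c"
| "prog_vars (Output e) = expr_vars e"

lemma finite_expr_vars: "finite (expr_vars e)"
  by (induction e) auto

lemma finite_prog_vars: "finite (prog_vars c)"
  by (induction c) (auto simp: finite_expr_vars)

lemma eval_cong: "(\<And>x. x \<in> expr_vars e \<Longrightarrow> s x = r x) \<Longrightarrow> eval e s = eval e r"
  by (induction e) auto

abbreviation TrueE :: expr where
  "TrueE \<equiv> ConsE NilE NilE"

section \<open>Simulation of a program with an output flag\<close>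

fun flag_outputs :: "nat \<Rightarrow> prog \<Rightarrow> prog" where
  "flag_outputs k Skip = Skip"
| "flag_outputs k (Assign x e) = Assign x e"
| "flag_outputs k (Seq c d) = Seq (flag_outputs k c) (flag_outputs k d)"
| "flag_outputs k (If e c d) = If e (flag_outputs k c) (flag_outputs k d)"
| "flag_outputs k (While e c) = While e (flag_outputs k c)"
| "flag_outputs k (Output e) = Seq (Output e) (Assign k TrueE)"

text \<open>The four ticks pay for \<open>Assign k TrueE\<close>: one for the assignment, three for
  the expression.\<close>

fun flagged :: "event list \<Rightarrow> event list" where
  "flagged [] = []"
| "flagged (Tick # t) = Tick # flagged t"
| "flagged (Emit d # t) = Emit d # ticks 4 @ flagged t"

lemma flagged_append: "flagged (t @ t') = flagged t @ flagged t'"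
  by (induction t rule: flagged.induct) auto

lemma flagged_ticks [simp]: "flagged (ticks k) = ticks k"
  by (induction k) auto

lemma outputs_append [simp]: "outputs (t @ t') = outputs t @ outputs t'"
  by (induction t rule: outputs.induct) auto

lemma outputs_ticks [simp]: "outputs (ticks k) = []"
  by (induction k) auto

lemma outputs_flagged [simp]: "outputs (flagged t) = outputs t"
  by (induction t rule: flagged.induct) auto

text \<open>Here \<open>s'\<close> is the final store of the original run, while \<open>r\<close>
  and \<open>r'\<close> are the initial and final stores of the simulating run.\<close>

definition flagged_store :: "nat \<Rightarrow> event list \<Rightarrow> store \<Rightarrow> store \<Rightarrow> store \<Rightarrow> bool" where
  "flagged_store k t r s' r' \<longleftrightarrow> (\<forall>x<k. r' x = s' x) \<and> (\<forall>x>k. r' x = r x) \<and>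
     r' k = (if outputs t = [] then r k else Cs Nl Nl)"

lemma flagged_store_append:
  assumes "flagged_store k t r s' r'" "flagged_store k t' r' s'' r''"
  shows "flagged_store k (t @ t') r s'' r''"
  using assms by (auto simp: flagged_store_def)

lemma flagged_store_ticks:
  assumes "flagged_store k t r s' r'"
  shows "flagged_store k (ticks n @ t) r s' r'"
  using assms by (auto simp: flagged_store_def)

lemma flagged_store_agree: "flagged_store k t r s' r' \<Longrightarrow> \<forall>x<k. r' x = s' x"
  by (simp add: flagged_store_def)

lemma exec_Assign:
  "n = 1 + expr_cost e \<Longrightarrow> s' = s(x := eval e s) \<Longrightarrow> exec (Assign x e) s (ticks n) s'"
  using exec.Assign by simp

lemma exec_Seq_ticks:
  "exec c s (ticks m) s' \<Longrightarrow> exec d s' (ticks n) s'' \<Longrightarrow> exec (Seq c d) s (ticks (m + n)) s''"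
  unfolding replicate_add by (rule exec.Seq)

text \<open>The program reads only registers below \<open>k\<close>, where the two stores agree all
  along, so both runs take the same branches. From \<open>k\<close> on the stores may differ: there
  the caller keeps its data.\<close>

lemma exec_flag_outputs:
  assumes "exec c s t s'" "prog_vars c \<subseteq> {..<k}" "\<forall>x<k. r x = s x"
  shows "\<exists>r'. exec (flag_outputs k c) r (flagged t) r' \<and> flagged_store k t r s' r'"
  using assms
proof (induction arbitrary: r rule: exec.induct)
  case (Skip s)
  then show ?case using exec.Skip[of r] by (auto simp: flagged_store_def)
next
  case (Assign x e s)
  have "eval e r = eval e s" by (rule eval_cong) (use Assign in auto)
  then show ?case
    using Assign exec.Assign[of x e r] by (auto simp: flagged_store_def simp del: replicate.simps)
next
  case (Seq c s t s' d t' s'')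
  have c: "prog_vars c \<subseteq> {..<k}" and d: "prog_vars d \<subseteq> {..<k}" using Seq.prems by auto
  from Seq.IH(1)[OF c Seq.prems(2)] obtain r1 where
    r1: "exec (flag_outputs k c) r (flagged t) r1" "flagged_store k t r s' r1" by blast
  from Seq.IH(2)[OF d flagged_store_agree[OF r1(2)]] obtain r2 where
    r2: "exec (flag_outputs k d) r1 (flagged t') r2" "flagged_store k t' r1 s'' r2" by blast
  show ?case
    unfolding flagged_append flag_outputs.simps
    using exec.Seq[OF r1(1) r2(1)] flagged_store_append[OF r1(2) r2(2)] by blast
next
  case (IfTrue e s c t s' d)
  have e: "eval e r = eval e s" by (rule eval_cong) (use IfTrue.prems in auto)
  have c: "prog_vars c \<subseteq> {..<k}" using IfTrue.prems by auto
  from IfTrue.IH[OF c IfTrue.prems(2)] obtain r' where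
    r': "exec (flag_outputs k c) r (flagged t) r'" "flagged_store k t r s' r'" by blast
  have "eval e r \<noteq> Nl" using e IfTrue.hyps by simp
  then show ?case
    unfolding flagged_append flag_outputs.simps flagged_ticks
    using exec.IfTrue[OF _ r'(1)] flagged_store_ticks[OF r'(2)] by blast
next
  case (IfFalse e s d t s' c)
  have e: "eval e r = eval e s" by (rule eval_cong) (use IfFalse.prems in auto)
  have d: "prog_vars d \<subseteq> {..<k}" using IfFalse.prems by auto
  from IfFalse.IH[OF d IfFalse.prems(2)] obtain r' where
    r': "exec (flag_outputs k d) r (flagged t) r'" "flagged_store k t r s' r'" by blast
  have "eval e r = Nl" using e IfFalse.hyps by simp
  then show ?case
    unfolding flagged_append flag_outputs.simps flagged_ticks
    using exec.IfFalse[OF _ r'(1)] flagged_store_ticks[OF r'(2)] by blast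
next
  case (WhileFalse e s c)
  have e: "eval e r = eval e s" by (rule eval_cong) (use WhileFalse.prems in auto)
  have "eval e r = Nl" using e WhileFalse.hyps by simp
  moreover have "flagged_store k (ticks (1 + expr_cost e)) r s r"
    using WhileFalse.prems by (auto simp: flagged_store_def simp del: replicate.simps)
  ultimately show ?case
    unfolding flag_outputs.simps flagged_ticks using exec.WhileFalse by blast
next
  case (WhileTrue e s c t s' t' s'')
  have e: "eval e r = eval e s" by (rule eval_cong) (use WhileTrue.prems in auto)
  have c: "prog_vars c \<subseteq> {..<k}" using WhileTrue.prems by auto
  from WhileTrue.IH(1)[OF c WhileTrue.prems(2)] obtain r1 where
    r1: "exec (flag_outputs k c) r (flagged t) r1" "flagged_store k t r s' r1" by blast
  from WhileTrue.IH(2)[OF WhileTrue.prems(1) flagged_store_agree[OF r1(2)]] obtain r2 where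
    r2: "exec (flag_outputs k (While e c)) r1 (flagged t') r2" "flagged_store k t' r1 s'' r2"
    by blast
  have "eval e r \<noteq> Nl" using e WhileTrue.hyps by simp
  then have "exec (While e (flag_outputs k c)) r
      (ticks (1 + expr_cost e) @ flagged t @ flagged t') r2"
    using r1(1) r2(1) unfolding flag_outputs.simps by (rule exec.WhileTrue)
  then show ?case
    unfolding flagged_append flag_outputs.simps flagged_ticks
    using flagged_store_ticks[OF flagged_store_append[OF r1(2) r2(2)]] by blast
next
  case (Output e s)
  have e: "eval e r = eval e s" by (rule eval_cong) (use Output in auto)
  have "exec (Assign k TrueE) r (ticks 4) (r(k := Cs Nl Nl))"
    by (rule exec_Assign) simp_all
  with exec.Output have "exec (Seq (Output e) (Assign k TrueE)) r
      ((ticks (1 + expr_cost e + size (eval e r)) @ [Emit (eval e r)]) @ ticks 4)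
      (r(k := Cs Nl Nl))"
    by (rule exec.Seq)
  moreover have "flagged (ticks (1 + expr_cost e + size (eval e s)) @ [Emit (eval e s)]) =
      (ticks (1 + expr_cost e + size (eval e r)) @ [Emit (eval e r)]) @ ticks 4"
    unfolding flagged_append flagged_ticks e by simp
  ultimately have "exec (flag_outputs k (Output e)) r
      (flagged (ticks (1 + expr_cost e + size (eval e s)) @ [Emit (eval e s)])) (r(k := Cs Nl Nl))"
    by simp
  then show ?case using Output by (auto simp: flagged_store_def)
qed

section \<open>Repeated calls and list reversal\<close>

text \<open>\<open>run\<close> starts with empty registers except for the input, so a repeated call
  has to erase what the previous one left behind.\<close>

fun clear :: "nat \<Rightarrow> prog" where
  "clear 0 = Skip"
| "clear (Suc i) = Seq (clear i) (Assign i NilE)"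

lemma exec_clear: "exec (clear i) s (ticks (1 + 2 * i)) (\<lambda>x. if x < i then Nl else s x)"
proof (induction i)
  case 0
  show ?case using exec.Skip by simp
next
  case (Suc i)
  have "exec (clear (Suc i)) s (ticks (1 + 2 * i) @ ticks (1 + expr_cost NilE))
    ((\<lambda>x. if x < i then Nl else s x)(i := eval NilE (\<lambda>x. if x < i then Nl else s x)))"
    unfolding clear.simps by (rule exec.Seq[OF Suc exec.Assign])
  moreover have "ticks (1 + 2 * i) @ ticks (1 + expr_cost NilE) = ticks (1 + 2 * Suc i)"
    unfolding replicate_add[symmetric] by simp
  moreover have "(\<lambda>x. if x < i then Nl else s x)(i := eval NilE (\<lambda>x. if x < i then Nl else s x))
      = (\<lambda>x. if x < Suc i then Nl else s x)"
    by (auto simp: fun_eq_iff less_Suc_eq)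
  ultimately show ?case by simp
qed

text \<open>
  The subroutine owns the variables below \<open>k\<close>, and variable \<open>k\<close> records whether it produced an
  output.  The variables above \<open>k\<close> belong to the caller.
\<close>

definition call :: "nat \<Rightarrow> prog \<Rightarrow> prog" where
  "call k c = Seq (clear (Suc k))
     (Seq (Assign 0 (ConsE (Var (k + 1)) (Var (k + 2)))) (flag_outputs k c))"

text \<open>The overhead is \<open>2 * k + 3\<close> for erasing the registers up to the flag and 4
  for building the input. By \<open>0 < k\<close> the input register 0 is not the flag.\<close>

lemma exec_call:
  assumes "prog_vars c \<subseteq> {..<k}" "0 < k" "run c (Cs (s (k + 1)) (s (k + 2))) t"
  shows "\<exists>s'. exec (call k c) s (ticks (2 * k + 7) @ flagged t) s' \<and> (\<forall>x>k. s' x = s x) \<and>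
    (s' k = Nl \<longleftrightarrow> outputs t = [])"
proof -
  define s1 where "s1 = (\<lambda>x. if x < Suc k then Nl else s x)"
  define s2 where "s2 = s1(0 := Cs (s (k + 1)) (s (k + 2)))"
  have 1: "exec (clear (Suc k)) s (ticks (1 + 2 * Suc k)) s1"
    unfolding s1_def by (rule exec_clear)
  have 2: "exec (Assign 0 (ConsE (Var (k + 1)) (Var (k + 2)))) s1 (ticks 4) s2"
    by (rule exec_Assign) (simp_all add: s2_def s1_def)
  obtain sf where sf: "exec c ((\<lambda>_. Nl)(0 := Cs (s (k + 1)) (s (k + 2)))) t sf"
    using assms(3) by (auto simp: run_def)
  have "\<forall>x<k. s2 x = ((\<lambda>_. Nl)(0 := Cs (s (k + 1)) (s (k + 2)))) x"
    by (simp add: s2_def s1_def)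
  from exec_flag_outputs[OF sf assms(1) this] obtain s' where
    s': "exec (flag_outputs k c) s2 (flagged t) s'" "flagged_store k t s2 sf s'" by blast
  have "exec (call k c) s (ticks (1 + 2 * Suc k) @ ticks 4 @ flagged t) s'"
    unfolding call_def by (intro exec.Seq[OF 1] exec.Seq[OF 2] s')
  moreover have "ticks (1 + 2 * Suc k) @ ticks 4 @ flagged t = ticks (2 * k + 7) @ flagged t"
    unfolding append_assoc[symmetric] replicate_add[symmetric] by simp
  moreover have "\<forall>x>k. s' x = s x"
    using s'(2) by (auto simp: flagged_store_def s2_def s1_def)
  moreover have "s' k = Nl \<longleftrightarrow> outputs t = []"
    using s'(2) assms(2) by (auto simp: flagged_store_def s2_def s1_def)
  ultimately show ?thesis by metis
qed

text \<open>With \<open>HeadE (Var u)\<close> for \<open>e\<close> this reverses one list onto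
  another; with \<open>NilE\<close> it counts out a list of zeros as long as the list in
  \<open>u\<close>.\<close>

definition rev_onto :: "nat \<Rightarrow> nat \<Rightarrow> expr \<Rightarrow> prog" where
  "rev_onto u w e = While (Var u) (Seq (Assign w (ConsE e (Var w))) (Assign u (TailE (Var u))))"

lemma exec_rev_onto:
  assumes "u \<noteq> w" "\<And>s. eval e s = h (head (s u))" "s u = enc_list xs" "s w = enc_list ys"
  shows "exec (rev_onto u w e) s (ticks (2 + length xs * (8 + expr_cost e)))
           (s(u := Nl, w := enc_list (rev (map h xs) @ ys)))"
  using assms(3,4)
proof (induction xs arbitrary: s ys)
  case Nil
  then have "s(u := Nl, w := enc_list (rev (map h []) @ ys)) = s" by auto
  moreover have "exec (rev_onto u w e) s (ticks (1 + expr_cost (Var u))) s"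
    using Nil unfolding rev_onto_def by (intro exec.WhileFalse) simp
  ultimately show ?case by (simp add: numeral_2_eq_2 del: fun_upd_apply)
next
  case (Cons x xs)
  let ?s1 = "s(w := enc_list (h x # ys))"
  let ?s2 = "?s1(u := enc_list xs)"
  have 1: "exec (Assign w (ConsE e (Var w))) s (ticks (3 + expr_cost e)) ?s1"
    using Cons.prems assms(2) by (intro exec_Assign) auto
  have 2: "exec (Assign u (TailE (Var u))) ?s1 (ticks 3) ?s2"
    using Cons.prems assms(1) by (intro exec_Assign) auto
  have 3: "exec (rev_onto u w e) ?s2 (ticks (2 + length xs * (8 + expr_cost e)))
      (?s2(u := Nl, w := enc_list (rev (map h xs) @ h x # ys)))"
    using assms(1) by (intro Cons.IH) auto
  have "exec (rev_onto u w e) s (ticks (1 + expr_cost (Var u)) @ ticks (3 + expr_cost e + 3)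
        @ ticks (2 + length xs * (8 + expr_cost e)))
      (?s2(u := Nl, w := enc_list (rev (map h xs) @ h x # ys)))"
    using Cons.prems 3 unfolding rev_onto_def
    by (intro exec.WhileTrue[OF _ exec_Seq_ticks[OF 1 2]]) auto
  moreover have "ticks (1 + expr_cost (Var u)) @ ticks (3 + expr_cost e + 3)
        @ ticks (2 + length xs * (8 + expr_cost e)) =
      ticks (2 + length (x # xs) * (8 + expr_cost e))"
    unfolding replicate_add[symmetric] by simp
  moreover have "?s2(u := Nl, w := enc_list (rev (map h xs) @ h x # ys)) =
      s(u := Nl, w := enc_list (rev (map h (x # xs)) @ ys))"
    using assms(1) by auto
  ultimately show ?case by (simp only:)
qed

section \<open>Depth-first search over the sets of vertices of value 2\<close>

text \<open>
  Besides the registers of \<^const>\<open>call\<close>, the caller uses variable \<open>k + 3\<close> for the stack, \<open>k + 4\<close>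
  and \<open>k + 5\<close> for the current node, and \<open>k + 6\<close> as a loop counter.  A node consists of the
  already decided bits, in reverse order, and of a list of zeros, one for each undecided bit.
  The set represented by a node contains no undecided vertex.
\<close>

abbreviation enc_bits :: "bool list \<Rightarrow> sexp" where
  "enc_bits b \<equiv> enc_list (map enc_bool b)"

abbreviation zeros :: "nat \<Rightarrow> bool list" where
  "zeros m \<equiv> replicate m False"

text \<open>With the decided bits reversed, deciding one more is a single cons. The stored zeros are
  at the same time the tail of the vectors to be tested.\<close>

definition node :: "bool list \<Rightarrow> nat \<Rightarrow> sexp" where
  "node p m = Cs (enc_bits (rev p)) (enc_bits (zeros m))"

definition pop :: "nat \<Rightarrow> prog" where
  "pop k = Seq (Assign (k + 4) (HeadE (HeadE (Var (k + 3)))))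
     (Seq (Assign (k + 5) (TailE (HeadE (Var (k + 3))))) (Assign (k + 3) (TailE (Var (k + 3)))))"

definition push :: "nat \<Rightarrow> expr \<Rightarrow> prog" where
  "push k e = Assign (k + 3) (ConsE (ConsE (ConsE e (Var (k + 4))) (Var (k + 5))) (Var (k + 3)))"

text \<open>The subroutine is called on the vector in which the next vertex is included and all
  later ones are absent. Register \<open>k + 4\<close> is copied because \<open>rev_onto\<close>
  consumes its source.\<close>

definition try_next :: "nat \<Rightarrow> prog \<Rightarrow> prog" where
  "try_next k c = Seq (Assign (k + 5) (TailE (Var (k + 5))))
     (Seq (Assign (k + 2) (ConsE TrueE (Var (k + 5))))
     (Seq (Assign (k + 6) (Var (k + 4)))
     (Seq (rev_onto (k + 6) (k + 2) (HeadE (Var (k + 6))))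
     (call k c))))"

text \<open>Excluding the next vertex does not change the set, so that child is pushed whatever the
  call yields. The including child is pushed last and hence explored first.\<close>

definition search_step :: "nat \<Rightarrow> prog \<Rightarrow> prog" where
  "search_step k c = Seq (pop k) (If (Var (k + 5))
     (Seq (try_next k c) (Seq (push k NilE) (If (Var k) (push k TrueE) Skip))) Skip)"

definition search_loop :: "nat \<Rightarrow> prog \<Rightarrow> prog" where
  "search_loop k c = While (Var (k + 3)) (search_step k c)"

text \<open>The empty set is the only one that does not arise by including a vertex, hence its
  separate call. Its vector is counted out along the encoding of the graph, which has one entry per
  vertex.\<close>

definition search :: "nat \<Rightarrow> prog \<Rightarrow> prog" where
  "search k c = Seq (Assign (k + 1) (Var 0)) (Seq (Assign (k + 6) (Var 0))
     (Seq (rev_onto (k + 6) (k + 2) NilE)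
     (Seq (call k c)
     (Seq (If (Var k) (Assign (k + 3) (ConsE (ConsE NilE (Var (k + 2))) NilE)) Skip)
     (search_loop k c)))))"

section \<open>Runs of one search step\<close>

lemma exec_pop:
  "exec (pop k) s (ticks 11) (s(k + 4 := head (head (s (k + 3))),
     k + 5 := tail (head (s (k + 3))), k + 3 := tail (s (k + 3))))"
proof -
  let ?s1 = "s(k + 4 := head (head (s (k + 3))))"
  let ?s2 = "?s1(k + 5 := tail (head (s (k + 3))))"
  have "exec (Assign (k + 4) (HeadE (HeadE (Var (k + 3))))) s (ticks 4) ?s1"
    by (rule exec_Assign) simp_all
  moreover have "exec (Assign (k + 5) (TailE (HeadE (Var (k + 3))))) ?s1 (ticks 4) ?s2"
    by (rule exec_Assign) simp_all
  moreover have "exec (Assign (k + 3) (TailE (Var (k + 3)))) ?s2 (ticks 3)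
      (?s2(k + 3 := tail (s (k + 3))))"
    by (rule exec_Assign) simp_all
  ultimately have "exec (pop k) s (ticks (4 + (4 + 3))) (?s2(k + 3 := tail (s (k + 3))))"
    unfolding pop_def by (blast intro: exec_Seq_ticks)
  then show ?thesis by simp
qed

lemma exec_push:
  "exec (push k e) s (ticks (7 + expr_cost e))
     (s(k + 3 := Cs (Cs (Cs (eval e s) (s (k + 4))) (s (k + 5))) (s (k + 3))))"
  unfolding push_def by (rule exec_Assign) simp_all

lemma ticks_append: "ticks a @ ticks b = ticks (a + b)" "ticks a @ ticks b @ t = ticks (a + b) @ t"
  by (simp_all add: replicate_add)

lemma exec_Seq_trace:
  "exec c s t s' \<Longrightarrow> exec d s' t' s'' \<Longrightarrow> t'' = t @ t' \<Longrightarrow> exec (Seq c d) s t'' s''"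
  using exec.Seq by simp

lemma exec_If_Var:
  assumes "exec (if s x = Nl then d else c) s t s'"
  shows "exec (If (Var x) c d) s (ticks 2 @ t) s'"
  using assms exec.IfTrue[of "Var x" s c t s' d] exec.IfFalse[of "Var x" s d t s' c]
  by (auto simp: numeral_2_eq_2 split: if_splits)

lemma exec_try_next:
  assumes "prog_vars c \<subseteq> {..<k}" "0 < k"
    and p: "s (k + 4) = enc_bits (rev p)" and m: "s (k + 5) = enc_bits (zeros (Suc m))"
    and run: "run c (Cs (s (k + 1)) (enc_bits (p @ True # zeros m))) t"
  shows "\<exists>s'. exec (try_next k c) s (ticks (2 * k + 10 * length p + 20) @ flagged t) s' \<and>
    s' (k + 1) = s (k + 1) \<and> s' (k + 3) = s (k + 3) \<and> s' (k + 4) = s (k + 4) \<and>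
    s' (k + 5) = enc_bits (zeros m) \<and> (s' k = Nl \<longleftrightarrow> outputs t = [])"
proof -
  define s1 where "s1 = s(k + 5 := enc_bits (zeros m))"
  define s2 where "s2 = s1(k + 2 := enc_bits (True # zeros m))"
  define s3 where "s3 = s2(k + 6 := enc_bits (rev p))"
  define s4 where "s4 = s3(k + 6 := Nl, k + 2 := enc_bits (p @ True # zeros m))"
  have 1: "exec (Assign (k + 5) (TailE (Var (k + 5)))) s (ticks 3) s1"
    by (rule exec_Assign) (use m in \<open>simp_all add: s1_def\<close>)
  have 2: "exec (Assign (k + 2) (ConsE TrueE (Var (k + 5)))) s1 (ticks 6) s2"
    by (rule exec_Assign) (simp_all add: s2_def s1_def enc_bool_def)
  have 3: "exec (Assign (k + 6) (Var (k + 4))) s2 (ticks 2) s3"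
    by (rule exec_Assign) (use p in \<open>simp_all add: s3_def s2_def s1_def\<close>)
  have "exec (rev_onto (k + 6) (k + 2) (HeadE (Var (k + 6)))) s3
      (ticks (2 + length (map enc_bool (rev p)) * (8 + expr_cost (HeadE (Var (k + 6))))))
      (s3(k + 6 := Nl, k + 2 := enc_list (rev (map id (map enc_bool (rev p))) @
         map enc_bool (True # zeros m))))"
    by (rule exec_rev_onto) (simp_all add: s3_def s2_def)
  then have 4: "exec (rev_onto (k + 6) (k + 2) (HeadE (Var (k + 6)))) s3
      (ticks (2 + 10 * length p)) s4"
    by (simp add: s4_def rev_map mult.commute del: fun_upd_apply)
  have same: "s4 (k + 1) = s (k + 1)" "s4 (k + 2) = enc_bits (p @ True # zeros m)"
      "s4 (k + 3) = s (k + 3)" "s4 (k + 4) = s (k + 4)" "s4 (k + 5) = enc_bits (zeros m)"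
    by (simp_all add: s4_def s3_def s2_def s1_def)
  have "run c (Cs (s4 (k + 1)) (s4 (k + 2))) t" using run same by simp
  from exec_call[OF assms(1,2) this] obtain s' where s':
    "exec (call k c) s4 (ticks (2 * k + 7) @ flagged t) s'" "\<forall>x>k. s' x = s4 x"
    "s' k = Nl \<longleftrightarrow> outputs t = []" by blast
  have "exec (try_next k c) s
      (ticks 3 @ ticks 6 @ ticks 2 @ ticks (2 + 10 * length p) @ ticks (2 * k + 7) @ flagged t) s'"
    unfolding try_next_def
    by (rule exec.Seq[OF 1] exec.Seq[OF 2] exec.Seq[OF 3] exec.Seq[OF 4] s'(1))+
  moreover have "ticks 3 @ ticks 6 @ ticks 2 @ ticks (2 + 10 * length p) @ ticks (2 * k + 7) @ flagged t
      = ticks (2 * k + 10 * length p + 20) @ flagged t"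
    unfolding ticks_append by (simp add: ac_simps)
  ultimately have "exec (try_next k c) s (ticks (2 * k + 10 * length p + 20) @ flagged t) s'"
    by (simp only:)
  moreover have "s' (k + 1) = s (k + 1)" "s' (k + 3) = s (k + 3)" "s' (k + 4) = s (k + 4)"
    "s' (k + 5) = enc_bits (zeros m)" using s'(2) same by auto
  ultimately show ?thesis using s'(3) by blast
qed

lemma exec_search_step_leaf:
  assumes "s (k + 3) = Cs (node p 0) S"
  shows "\<exists>s'. exec (search_step k c) s (ticks 14) s' \<and> s' (k + 1) = s (k + 1) \<and> s' (k + 3) = S"
proof -
  define s1 where "s1 = s(k + 4 := head (head (s (k + 3))), k + 5 := tail (head (s (k + 3))),
    k + 3 := tail (s (k + 3)))"
  have s1: "s1 (k + 1) = s (k + 1)" "s1 (k + 3) = S" "s1 (k + 5) = Nl"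
    using assms by (simp_all add: s1_def node_def)
  have "exec (If (Var (k + 5)) d Skip) s1 (ticks 2 @ ticks 1) s1" for d
    by (rule exec_If_Var) (use s1 exec.Skip in simp)
  then have "exec (search_step k c) s (ticks (11 + (2 + 1))) s1"
    unfolding search_step_def ticks_append
    by (rule exec_Seq_ticks[OF exec_pop[of k s, folded s1_def]])
  then have "exec (search_step k c) s (ticks 14) s1" by simp
  then show ?thesis using s1 by blast
qed

lemma exec_search_step_inner:
  assumes "prog_vars c \<subseteq> {..<k}" "0 < k"
    and st: "s (k + 3) = Cs (node p (Suc m)) S"
    and run: "run c (Cs (s (k + 1)) (enc_bits (p @ True # zeros m))) t"
  shows "\<exists>s' b. exec (search_step k c) s
      (ticks (2 * k + 10 * length p + 33) @ flagged t @ ticks b) s' \<and> b \<le> 20 \<and>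
    s' (k + 1) = s (k + 1) \<and>
    s' (k + 3) = (if outputs t = [] then Cs (node (p @ [False]) m) S
      else Cs (node (p @ [True]) m) (Cs (node (p @ [False]) m) S))"
proof -
  define s1 where "s1 = s(k + 4 := head (head (s (k + 3))), k + 5 := tail (head (s (k + 3))),
    k + 3 := tail (s (k + 3)))"
  have s1: "s1 (k + 1) = s (k + 1)" "s1 (k + 3) = S" "s1 (k + 4) = enc_bits (rev p)"
    "s1 (k + 5) = enc_bits (zeros (Suc m))"
    using st by (simp_all add: s1_def node_def)
  have "run c (Cs (s1 (k + 1)) (enc_bits (p @ True # zeros m))) t" using run s1 by simp
  from exec_try_next[OF assms(1,2) s1(3,4) this] obtain s2 where
    ex2: "exec (try_next k c) s1 (ticks (2 * k + 10 * length p + 20) @ flagged t) s2" and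
    s2: "s2 (k + 1) = s (k + 1)" "s2 (k + 3) = S" "s2 (k + 4) = enc_bits (rev p)"
    "s2 (k + 5) = enc_bits (zeros m)" "s2 k = Nl \<longleftrightarrow> outputs t = []"
    using s1 by auto
  define s3 where "s3 = s2(k + 3 := Cs (node (p @ [False]) m) S)"
  have ex3: "exec (push k NilE) s2 (ticks 8) s3"
    using exec_push[of k NilE s2] s2 by (simp add: s3_def node_def enc_bool_def)
  define s4 where "s4 = (if outputs t = [] then s3
    else s3(k + 3 := Cs (node (p @ [True]) m) (Cs (node (p @ [False]) m) S)))"
  have s3: "s3 k = Nl \<longleftrightarrow> outputs t = []" "s3 (k + 1) = s (k + 1)" using s2 by (auto simp: s3_def)
  \<comment> \<open>Pushing with \<open>TrueE\<close> costs 7 + 3, the alternative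
    \<open>Skip\<close> costs 1.\<close>
  have "\<exists>b\<le>10. exec (if s3 k = Nl then Skip else push k TrueE) s3 (ticks b) s4"
  proof (cases "outputs t = []")
    case True
    then show ?thesis using s3 exec.Skip[of s3] by (intro exI[of _ 1]) (simp add: s4_def)
  next
    case False
    have "exec (push k TrueE) s3 (ticks 10) s4"
      using exec_push[of k TrueE s3] s2 False
      by (simp add: s4_def s3_def node_def enc_bool_def del: replicate.simps)
    then show ?thesis using s3 False by auto
  qed
  then obtain b where b: "b \<le> 10" "exec (if s3 k = Nl then Skip else push k TrueE) s3 (ticks b) s4"
    by blast
  note ex4 = exec_If_Var[OF b(2)]
  have ne: "s1 (k + 5) \<noteq> Nl" using s1 by simp
  have "exec (Seq (try_next k c) (Seq (push k NilE) (If (Var k) (push k TrueE) Skip))) s1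
      ((ticks (2 * k + 10 * length p + 20) @ flagged t) @ ticks 8 @ ticks 2 @ ticks b) s4"
    by (rule exec.Seq[OF ex2 exec.Seq[OF ex3 ex4]])
  with ne have "exec (If (Var (k + 5))
        (Seq (try_next k c) (Seq (push k NilE) (If (Var k) (push k TrueE) Skip))) Skip) s1
      (ticks 2 @ (ticks (2 * k + 10 * length p + 20) @ flagged t) @ ticks 8 @ ticks 2 @ ticks b) s4"
    by (intro exec_If_Var) simp
  then have "exec (search_step k c) s
      (ticks (2 * k + 10 * length p + 33) @ flagged t @ ticks (10 + b)) s4"
    unfolding search_step_def
    by (rule exec_Seq_trace[OF exec_pop[of k s, folded s1_def]])
      (unfold append_assoc ticks_append, simp add: ac_simps)
  moreover have "s4 (k + 1) = s (k + 1)" using s3 by (simp add: s4_def)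
  moreover have "s4 (k + 3) = (if outputs t = [] then Cs (node (p @ [False]) m) S
      else Cs (node (p @ [True]) m) (Cs (node (p @ [False]) m) S))"
    by (simp add: s4_def s3_def)
  moreover have "10 + b \<le> 20" using b by simp
  ultimately show ?thesis by blast
qed

text \<open>
  The traces of the exploration of the subtree below the decided bits \<open>p\<close> with \<open>m\<close> undecided bits,
  if \<open>\<tau> b\<close> is the trace of the subroutine on the set \<open>b\<close> and the overheads are at most \<open>H\<close>.
\<close>

inductive walk :: "(bool list \<Rightarrow> event list) \<Rightarrow> nat \<Rightarrow> bool list \<Rightarrow> nat \<Rightarrow> event list \<Rightarrow> bool"
  for \<tau> H where
  leaf: "a \<le> H \<Longrightarrow> walk \<tau> H p 0 (ticks a)"
| prune: "a \<le> H \<Longrightarrow> b \<le> H \<Longrightarrow> outputs (\<tau> (p @ True # zeros m)) = [] \<Longrightarrow>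
    walk \<tau> H (p @ [False]) m t0 \<Longrightarrow>
    walk \<tau> H p (Suc m) (ticks a @ flagged (\<tau> (p @ True # zeros m)) @ ticks b @ t0)"
| branch: "a \<le> H \<Longrightarrow> b \<le> H \<Longrightarrow> outputs (\<tau> (p @ True # zeros m)) \<noteq> [] \<Longrightarrow>
    walk \<tau> H (p @ [True]) m t1 \<Longrightarrow> walk \<tau> H (p @ [False]) m t0 \<Longrightarrow>
    walk \<tau> H p (Suc m) (ticks a @ flagged (\<tau> (p @ True # zeros m)) @ ticks b @ t1 @ t0)"

section \<open>Exploration of subtrees inside the loop\<close>

lemma exec_search_loop_step:
  assumes "s (k + 3) \<noteq> Nl" "exec (search_step k c) s t s'" "exec (search_loop k c) s' t' s''"
  shows "exec (search_loop k c) s (ticks 2 @ t @ t') s''"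
  using assms exec.WhileTrue[of "Var (k + 3)" s] unfolding search_loop_def
  by (simp add: numeral_2_eq_2)

text \<open>Exploring a subtree is only a prefix of the loop, whereas \<open>exec\<close> speaks of
  complete runs; hence the continuation form, which prepends \<open>t\<close> to every completed run
  from \<open>s'\<close>. The rest \<open>S\<close> of the stack is returned as found, so the
  explorations of two siblings can be chained.\<close>

lemma exec_search_loop:
  assumes "prog_vars c \<subseteq> {..<k}" "0 < k"
    and run: "\<And>b. length b = n \<Longrightarrow> run c (Cs g (enc_bits b)) (\<tau> b)"
    and H: "2 * k + 10 * n + 40 \<le> H"
    and "length p + m = n" "s (k + 1) = g" "s (k + 3) = Cs (node p m) S"
  shows "\<exists>t s'. walk \<tau> H p m t \<and> s' (k + 1) = g \<and> s' (k + 3) = S \<and>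
    (\<forall>t' s''. exec (search_loop k c) s' t' s'' \<longrightarrow> exec (search_loop k c) s (t @ t') s'')"
  using assms(5-)
proof (induction m arbitrary: p s S)
  case 0
  from exec_search_step_leaf[of s k p S c, OF 0(3)] obtain s' where
    s': "exec (search_step k c) s (ticks 14) s'" "s' (k + 1) = g" "s' (k + 3) = S"
    using 0 by auto
  have "exec (search_loop k c) s (ticks 16 @ t') s''" if "exec (search_loop k c) s' t' s''" for t' s''
  proof -
    have "exec (search_loop k c) s (ticks 2 @ ticks 14 @ t') s''"
      using 0 by (intro exec_search_loop_step[OF _ s'(1) that]) simp
    then show ?thesis by (simp add: ticks_append)
  qed
  moreover have "walk \<tau> H p 0 (ticks 16)" using H by (intro walk.leaf) simp
  ultimately show ?case using s' by blast
next
  case (Suc m)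
  define b where "b = p @ True # zeros m"
  have "length b = n" using Suc.prems by (simp add: b_def)
  then have "run c (Cs (s (k + 1)) (enc_bits b)) (\<tau> b)" using run Suc.prems by simp
  from exec_search_step_inner[OF assms(1,2) Suc.prems(3) this[unfolded b_def], folded b_def]
  obtain s1 d where
    s1: "exec (search_step k c) s (ticks (2 * k + 10 * length p + 33) @ flagged (\<tau> b) @ ticks d) s1"
      "d \<le> 20" "s1 (k + 1) = g" and
    st: "s1 (k + 3) = (if outputs (\<tau> b) = [] then Cs (node (p @ [False]) m) S
      else Cs (node (p @ [True]) m) (Cs (node (p @ [False]) m) S))"
    using Suc.prems by auto
  \<comment> \<open>33 from the search step and 2 from the loop test.\<close>
  define a where "a = 2 * k + 10 * length p + 35"
  have a: "a \<le> H" "d \<le> H" using H Suc.prems s1 by (auto simp: a_def)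
  have step: "exec (search_loop k c) s (ticks a @ flagged (\<tau> b) @ ticks d @ t') s''"
    if "exec (search_loop k c) s1 t' s''" for t' s''
  proof -
    have "exec (search_loop k c) s
        (ticks 2 @ (ticks (2 * k + 10 * length p + 33) @ flagged (\<tau> b) @ ticks d) @ t') s''"
      using Suc.prems by (intro exec_search_loop_step[OF _ s1(1) that]) simp
    then show ?thesis by (simp add: ticks_append a_def ac_simps)
  qed
  show ?case
  proof (cases "outputs (\<tau> b) = []")
    case True
    have "length (p @ [False]) + m = n" using Suc.prems by simp
    from Suc.IH[of "p @ [False]" s1 S, OF this s1(3)] st True obtain t0 s' where
      "walk \<tau> H (p @ [False]) m t0" "s' (k + 1) = g" "s' (k + 3) = S"
      "\<forall>t' s''. exec (search_loop k c) s' t' s'' \<longrightarrow> exec (search_loop k c) s1 (t0 @ t') s''"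
      by auto
    moreover from walk.prune[OF a True[unfolded b_def] this(1)]
    have "walk \<tau> H p (Suc m) (ticks a @ flagged (\<tau> b) @ ticks d @ t0)" by (simp add: b_def)
    ultimately show ?thesis using step by (metis append_assoc)
  next
    case False
    have l: "length (p @ [True]) + m = n" "length (p @ [False]) + m = n" using Suc.prems by auto
    from Suc.IH[of "p @ [True]" s1 "Cs (node (p @ [False]) m) S", OF l(1) s1(3)] st False obtain t1 s2 where 1:
      "walk \<tau> H (p @ [True]) m t1" "s2 (k + 1) = g" "s2 (k + 3) = Cs (node (p @ [False]) m) S"
      "\<forall>t' s''. exec (search_loop k c) s2 t' s'' \<longrightarrow> exec (search_loop k c) s1 (t1 @ t') s''"
      by auto
    from Suc.IH[of "p @ [False]" s2 S, OF l(2) 1(2,3)] obtain t0 s' where 0: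
      "walk \<tau> H (p @ [False]) m t0" "s' (k + 1) = g" "s' (k + 3) = S"
      "\<forall>t' s''. exec (search_loop k c) s' t' s'' \<longrightarrow> exec (search_loop k c) s2 (t0 @ t') s''"
      by auto
    from walk.branch[OF a False[unfolded b_def] 1(1) 0(1)]
    have "walk \<tau> H p (Suc m) (ticks a @ flagged (\<tau> b) @ ticks d @ t1 @ t0)" by (simp add: b_def)
    with 0 1 step show ?thesis by (metis append_assoc)
  qed
qed

text \<open>The segments are the call on the empty set, the walk from the root, and the failing loop
  test. If the empty set has no solutions, the stack stays empty and there is no walk.\<close>

definition search_trace :: "(bool list \<Rightarrow> event list) \<Rightarrow> nat \<Rightarrow> nat \<Rightarrow> event list \<Rightarrow> bool" where
  "search_trace \<tau> H n t \<longleftrightarrow> (\<exists>a b d t'. t = ticks a @ flagged (\<tau> (zeros n)) @ ticks b @ t' @ ticks d \<and>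
     a \<le> H \<and> b \<le> H \<and> d \<le> H \<and>
     (if outputs (\<tau> (zeros n)) = [] then t' = [] else walk \<tau> H [] n t'))"

lemma run_search:
  assumes "prog_vars c \<subseteq> {..<k}" "0 < k"
    and run: "\<And>b. length b = length xs \<Longrightarrow> run c (Cs (enc_list xs) (enc_bits b)) (\<tau> b)"
    and H: "2 * k + 10 * length xs + 40 \<le> H"
  shows "\<exists>t. run (search k c) (enc_list xs) t \<and> search_trace \<tau> H (length xs) t"
proof -
  define n where "n = length xs"
  define g where "g = enc_list xs"
  define s0 :: store where "s0 = (\<lambda>_. Nl)(0 := g)"
  define s1 where "s1 = s0(k + 1 := g)"
  define s2 where "s2 = s1(k + 6 := g)"
  define s3 where "s3 = s2(k + 6 := Nl, k + 2 := enc_bits (zeros n))"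
  have 1: "exec (Assign (k + 1) (Var 0)) s0 (ticks 2) s1"
    by (rule exec_Assign) (simp_all add: s1_def s0_def)
  have 2: "exec (Assign (k + 6) (Var 0)) s1 (ticks 2) s2"
    by (rule exec_Assign) (simp_all add: s2_def s1_def s0_def)
  have "exec (rev_onto (k + 6) (k + 2) NilE) s2 (ticks (2 + length xs * (8 + expr_cost NilE)))
      (s2(k + 6 := Nl, k + 2 := enc_list (rev (map (\<lambda>_. Nl) xs) @ [])))"
    by (rule exec_rev_onto) (simp_all add: s2_def s1_def s0_def g_def)
  then have 3: "exec (rev_onto (k + 6) (k + 2) NilE) s2 (ticks (2 + 9 * n)) s3"
    by (simp add: s3_def map_replicate_const enc_bool_def n_def mult.commute del: fun_upd_apply)
  have s3: "s3 (k + 1) = g" "s3 (k + 2) = enc_bits (zeros n)" "s3 (k + 3) = Nl"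
    using assms(2) by (simp_all add: s3_def s2_def s1_def s0_def)
  have "run c (Cs (s3 (k + 1)) (s3 (k + 2))) (\<tau> (zeros n))"
    using run[of "zeros n"] unfolding s3 n_def g_def by simp
  from exec_call[OF assms(1,2) this] obtain s4 where
    4: "exec (call k c) s3 (ticks (2 * k + 7) @ flagged (\<tau> (zeros n))) s4" and
    s4: "\<forall>x>k. s4 x = s3 x" "s4 k = Nl \<longleftrightarrow> outputs (\<tau> (zeros n)) = []" by blast
  \<comment> \<open>Two copies at 2 each, \<open>2 + 9 * n\<close> for the list of zeros, and
    \<open>2 * k + 7\<close> of overhead for the call.\<close>
  define a where "a = 2 * k + 9 * n + 13"
  have a: "a \<le> H" using H by (simp add: a_def n_def)
  have search: "exec (search k c) s0 (ticks a @ flagged (\<tau> (zeros n)) @ t @ t') s''"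
    if 5: "exec (If (Var k) (Assign (k + 3) (ConsE (ConsE NilE (Var (k + 2))) NilE)) Skip) s4 t s5"
    and 6: "exec (search_loop k c) s5 t' s''" for t s5 t' s''
  proof -
    have "exec (search k c) s0 (ticks 2 @ ticks 2 @ ticks (2 + 9 * n) @
        (ticks (2 * k + 7) @ flagged (\<tau> (zeros n))) @ t @ t') s''"
      unfolding search_def
      by (rule exec.Seq[OF 1] exec.Seq[OF 2] exec.Seq[OF 3] exec.Seq[OF 4] exec.Seq[OF 5 6])+
    then show ?thesis unfolding append_assoc ticks_append a_def by (simp add: ac_simps)
  qed
  have stop: "exec (search_loop k c) s (ticks 2) s" if "s (k + 3) = Nl" for s
    using that exec.WhileFalse[of "Var (k + 3)" s] unfolding search_loop_def
    by (simp add: numeral_2_eq_2)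
  have "\<exists>t s''. exec (search k c) s0 t s'' \<and> search_trace \<tau> H n t"
  proof (cases "outputs (\<tau> (zeros n)) = []")
    case True
    have 5: "exec (If (Var k) (Assign (k + 3) (ConsE (ConsE NilE (Var (k + 2))) NilE)) Skip) s4
        (ticks 2 @ ticks 1) s4"
      by (rule exec_If_Var) (use s4 True exec.Skip in simp)
    have "exec (search_loop k c) s4 (ticks 2) s4" using s4 s3 by (intro stop) simp
    from search[OF 5 this]
    have "exec (search k c) s0 (ticks a @ flagged (\<tau> (zeros n)) @ ticks 3 @ [] @ ticks 2) s4"
      unfolding append_assoc ticks_append append_Nil by simp
    moreover have "3 \<le> H" "2 \<le> H" using H by auto
    ultimately show ?thesis unfolding search_trace_def using a True by metis
  next
    case False
    define s5 where "s5 = s4(k + 3 := Cs (node [] n) Nl)"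
    have "exec (Assign (k + 3) (ConsE (ConsE NilE (Var (k + 2))) NilE)) s4 (ticks 6) s5"
      by (rule exec_Assign) (use s4 s3 in \<open>simp_all add: s5_def node_def\<close>)
    then have 5: "exec (If (Var k) (Assign (k + 3) (ConsE (ConsE NilE (Var (k + 2))) NilE)) Skip) s4
        (ticks 2 @ ticks 6) s5"
      using s4 False by (intro exec_If_Var) simp
    have s5: "s5 (k + 1) = g" "s5 (k + 3) = Cs (node [] n) Nl" using s4 s3 by (simp_all add: s5_def)
    have n: "length [] + n = n" by simp
    from exec_search_loop[of c k n g \<tau> H "[]" n s5 Nl, OF assms(1,2) _ _ n s5] run H obtain t' s' where
      t': "walk \<tau> H [] n t'" "s' (k + 3) = Nl"
      "\<forall>t s''. exec (search_loop k c) s' t s'' \<longrightarrow> exec (search_loop k c) s5 (t' @ t) s''"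
      unfolding n_def g_def by auto
    then have "exec (search_loop k c) s5 (t' @ ticks 2) s'" using stop by blast
    from search[OF 5 this]
    have "exec (search k c) s0 (ticks a @ flagged (\<tau> (zeros n)) @ ticks 8 @ t' @ ticks 2) s'"
      unfolding append_assoc ticks_append by simp
    moreover have "8 \<le> H" "2 \<le> H" using H by auto
    ultimately show ?thesis unfolding search_trace_def using a False t'(1) by metis
  qed
  then show ?thesis unfolding run_def n_def s0_def g_def by blast
qed

section \<open>Outputs, time and delay of the search\<close>

text \<open>The vectors that belong to the subtree but not to its root: completing \<open>p\<close>
  by zeros gives the set of the node itself, which has been called before.\<close>

definition below :: "bool list \<Rightarrow> nat \<Rightarrow> bool list set" where
  "below p m = {p @ q | q. length q = m \<and> True \<in> set q}"

lemma zeros_if: "True \<notin> set q \<Longrightarrow> length q = m \<Longrightarrow> q = zeros m"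
  by (induction q arbitrary: m) auto

lemma below_0: "below p 0 = {}"
  by (auto simp: below_def)

text \<open>The inserted vector is the one called at the node; all others are split by the next
  bit.\<close>

lemma below_Suc:
  "below p (Suc m) = insert (p @ True # zeros m) (below (p @ [True]) m \<union> below (p @ [False]) m)"
    (is "?L = ?R")
proof
  show "?L \<subseteq> ?R"
  proof
    fix x assume "x \<in> ?L"
    then obtain b q where x: "x = p @ b # q" "length q = m" "b \<or> True \<in> set q"
      by (auto simp: below_def length_Suc_conv)
    show "x \<in> ?R"
    proof (cases "True \<in> set q")
      case True
      then show ?thesis using x by (cases b) (auto simp: below_def)
    next
      case False
      then have "q = zeros m" using x(2) by (rule zeros_if)
      then show ?thesis using x False by auto
    qed
  qed
  show "?R \<subseteq> ?L" by (auto simp: below_def)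
qed

lemma below_disjoint:
  "p @ True # zeros m \<notin> below (p @ [True]) m \<union> below (p @ [False]) m"
  "below (p @ [True]) m \<inter> below (p @ [False]) m = {}"
  by (auto simp: below_def)

lemma all_bits_eq: "{b. length b = n} = insert (zeros n) (below [] n)"
  using zeros_if[of _ n] by (auto simp: below_def)

lemma zeros_not_below: "zeros n \<notin> below [] n"
  by (auto simp: below_def)

lemma zeros_le: "length q = m \<Longrightarrow> list_all2 (\<le>) (zeros m) q"
  by (simp add: list_all2_conv_all_nth)

text \<open>The called vector is the least one on the including side, so by heredity a call without
  output empties that whole side.\<close>

lemma flip_le:
  assumes "length q = m"
  shows "list_all2 (\<le>) (p @ True # zeros m) (p @ True # q)"
  using zeros_le[OF assms] by (intro list_all2_appendI) (simp_all add: list_all2_refl)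

text \<open>These three facts are all that the analysis of the outputs takes from the graph.\<close>

locale subroutine_traces =
  fixes \<tau> :: "bool list \<Rightarrow> event list" and n :: nat
  assumes hereditary: "\<And>b b'. length b = n \<Longrightarrow> list_all2 (\<le>) b' b \<Longrightarrow> outputs (\<tau> b') = [] \<Longrightarrow>
      outputs (\<tau> b) = []"
    and disjoint: "\<And>b b'. length b = n \<Longrightarrow> length b' = n \<Longrightarrow> b \<noteq> b' \<Longrightarrow>
      set (outputs (\<tau> b)) \<inter> set (outputs (\<tau> b')) = {}"
    and distinct: "\<And>b. length b = n \<Longrightarrow> distinct (outputs (\<tau> b))"
begin

definition outs :: "bool list set \<Rightarrow> sexp set" where
  "outs B = (\<Union>b \<in> B. set (outputs (\<tau> b)))"

lemma outs_disjoint: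
  assumes "B \<inter> C = {}" "\<And>b. b \<in> B \<union> C \<Longrightarrow> length b = n"
  shows "outs B \<inter> outs C = {}"
proof -
  have "set (outputs (\<tau> b)) \<inter> set (outputs (\<tau> b')) = {}" if "b \<in> B" "b' \<in> C" for b b'
    using that assms by (intro disjoint) auto
  then show ?thesis unfolding outs_def by blast
qed

lemma outs_insert: "outs (insert b B) = set (outputs (\<tau> b)) \<union> outs B"
  and outs_Un: "outs (B \<union> C) = outs B \<union> outs C"
  and outs_empty: "outs {} = {}"
  by (auto simp: outs_def)

lemma walk_outputs:
  assumes "walk \<tau> H p m t" "length p + m = n"
  shows "distinct (outputs t) \<and> set (outputs t) = outs (below p m)"
  using assms
proof (induction rule: walk.induct)
  case (leaf a p)
  then show ?case by (simp add: below_0 outs_empty)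
next
  case (prune a b p m t0)
  have "outputs (\<tau> (p @ True # q)) = []" if "length q = m" for q
    using prune.prems that by (intro hereditary[OF _ flip_le[OF that] prune.hyps(3)]) simp
  then have "outs (below (p @ [True]) m) = {}" by (auto simp: outs_def below_def)
  then show ?case using prune by (simp add: below_Suc outs_insert outs_Un)
next
  case (branch a b p m t1 t0)
  let ?b = "p @ True # zeros m"
  have l: "length ?b = n" "length (p @ [True]) + m = n" "length (p @ [False]) + m = n"
    using branch.prems by auto
  have len: "length x = n" if "x \<in> insert ?b (below (p @ [True]) m \<union> below (p @ [False]) m)" for x
    using that l by (auto simp: below_def)
  have "outs {?b} \<inter> outs (below (p @ [True]) m \<union> below (p @ [False]) m) = {}"
    using below_disjoint(1)[of p m] len by (intro outs_disjoint) auto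
  moreover have "outs (below (p @ [True]) m) \<inter> outs (below (p @ [False]) m) = {}"
    using below_disjoint(2)[of p m] len by (intro outs_disjoint) auto
  ultimately show ?case
    using branch.IH(1)[OF l(2)] branch.IH(2)[OF l(3)] distinct[OF l(1)]
    by (auto simp: below_Suc outs_insert outs_Un outs_empty)
qed

lemma search_outputs:
  assumes "search_trace \<tau> H n t"
  shows "distinct (outputs t) \<and> set (outputs t) = outs {b. length b = n}"
proof -
  from assms obtain a b d t' where t: "t = ticks a @ flagged (\<tau> (zeros n)) @ ticks b @ t' @ ticks d"
    and t': "if outputs (\<tau> (zeros n)) = [] then t' = [] else walk \<tau> H [] n t'"
    by (auto simp: search_trace_def)
  show ?thesis
  proof (cases "outputs (\<tau> (zeros n)) = []")
    case True
    then have "outputs (\<tau> b) = []" if "length b = n" for b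
      using hereditary[OF that zeros_le[OF that]] by blast
    then show ?thesis using t t' by (auto simp: outs_def)
  next
    case False
    then have w: "distinct (outputs t') \<and> set (outputs t') = outs (below [] n)"
      using t' walk_outputs[of H "[]" n t'] by simp
    have "outs {zeros n} \<inter> outs (below [] n) = {}"
      using zeros_not_below by (intro outs_disjoint) (auto simp: below_def)
    then show ?thesis
      using w distinct[of "zeros n"] by (auto simp: t all_bits_eq outs_insert outs_empty)
  qed
qed

end

section \<open>Total running time\<close>

lemma run_time_append [simp]: "run_time (t @ t') = run_time t + run_time t'"
  by (simp add: run_time_def)

lemma run_time_ticks [simp]: "run_time (ticks k) = k"
  by (induction k) (auto simp: run_time_def)

lemma run_time_flagged: "run_time (flagged t) = run_time t + 4 * length (outputs t)"
proof (induction t rule: flagged.induct)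
  case (3 d t)
  have "run_time (Emit d # ticks 4 @ flagged t) = run_time [Emit d] + run_time (ticks 4 @ flagged t)"
    by (simp add: run_time_def)
  then show ?case using 3 unfolding run_time_append run_time_ticks by (simp add: run_time_def)
qed (simp_all add: run_time_def)

text \<open>
  A call without output is charged to the level of the search tree at which it occurs; every
  other call is paid for by its own outputs.
\<close>

lemma walk_run_time:
  assumes "walk \<tau> H p m t" "length p + m = n" "H \<le> K"
    and "\<And>b. length b = n \<Longrightarrow> 2 * H + run_time (flagged (\<tau> b)) \<le> K"
  shows "run_time t \<le> (m + 1) * K * (length (outputs t) + 1)"
  using assms(1,2)
proof (induction rule: walk.induct)
  case (leaf a p)
  then show ?case using assms(3) by simp
next
  case (prune a b p m t0)
  let ?N = "length (outputs t0)"
  have "run_time t0 \<le> (m + 1) * K * (?N + 1)" using prune.IH prune.prems by simp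
  moreover have "a + run_time (flagged (\<tau> (p @ True # zeros m))) + b \<le> K"
    using prune.hyps(1,2) prune.prems assms(4)[of "p @ True # zeros m"] by simp
  ultimately have "a + run_time (flagged (\<tau> (p @ True # zeros m))) + b + run_time t0
      \<le> K + (m + 1) * K * (?N + 1)" by linarith
  also have "\<dots> \<le> (Suc m + 1) * K * (?N + 1)" by (simp add: algebra_simps)
  finally show ?case using prune.hyps(3) by (simp add: add.assoc)
next
  case (branch a b p m t1 t0)
  let ?N1 = "length (outputs t1)" and ?N0 = "length (outputs t0)"
  let ?F = "length (outputs (\<tau> (p @ True # zeros m)))"
  have "run_time t0 \<le> (m + 1) * K * (?N0 + 1)" "run_time t1 \<le> (m + 1) * K * (?N1 + 1)"
    using branch.IH branch.prems by simp_all
  moreover have "a + run_time (flagged (\<tau> (p @ True # zeros m))) + b \<le> K"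
    using branch.hyps(1,2) branch.prems assms(4)[of "p @ True # zeros m"] by simp
  ultimately have "a + run_time (flagged (\<tau> (p @ True # zeros m))) + b + run_time t1 + run_time t0
      \<le> K + (m + 1) * K * (?N1 + 1) + (m + 1) * K * (?N0 + 1)" by linarith
  also have "\<dots> \<le> (Suc m + 1) * K * (?N1 + ?N0 + 2)" by (simp add: algebra_simps)
  \<comment> \<open>The call at a branching node has an output, so \<open>?F\<close> makes up for
    the second of the two units.\<close>
  also have "\<dots> \<le> (Suc m + 1) * K * (?F + ?N1 + ?N0 + 1)"
    using branch.hyps(3) by (intro mult_le_mono2) (simp add: Suc_le_eq)
  finally show ?case by (simp add: add.assoc)
qed

lemma search_run_time:
  assumes "search_trace \<tau> H n t" "H \<le> K"
    and K: "\<And>b. length b = n \<Longrightarrow> 2 * H + run_time (flagged (\<tau> b)) \<le> K"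
  shows "run_time t \<le> (n + 3) * K * (length (outputs t) + 1)"
proof -
  from assms obtain a b d t' where t: "t = ticks a @ flagged (\<tau> (zeros n)) @ ticks b @ t' @ ticks d"
    and H: "a \<le> H" "b \<le> H" "d \<le> H"
    and t': "if outputs (\<tau> (zeros n)) = [] then t' = [] else walk \<tau> H [] n t'"
    by (auto simp: search_trace_def)
  have "run_time t' \<le> (n + 1) * K * (length (outputs t') + 1)"
  proof (cases "outputs (\<tau> (zeros n)) = []")
    case True
    then show ?thesis using t' by (simp add: run_time_def)
  next
    case False
    then show ?thesis using t' walk_run_time[of \<tau> H "[]" n t' n K] assms by simp
  qed
  also have "\<dots> \<le> (n + 1) * K * (length (outputs t) + 1)"
    by (intro mult_le_mono2) (simp add: t)
  finally have "run_time t' \<le> (n + 1) * K * (length (outputs t) + 1)" .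
  moreover have "a + run_time (flagged (\<tau> (zeros n))) + b \<le> K" using K[of "zeros n"] H by simp
  \<comment> \<open>The additional summands \<open>K\<close> pay for the initial call and the final
    loop test.\<close>
  ultimately have "run_time t \<le> K + (n + 1) * K * (length (outputs t) + 1) + K"
    using H \<open>H \<le> K\<close> unfolding t by simp
  also have "\<dots> \<le> (n + 3) * K * (length (outputs t) + 1)" by (simp add: algebra_simps)
  finally show ?thesis .
qed

section \<open>Delay\<close>

text \<open>For a trace entered \<open>j\<close> ticks after the latest output, \<open>since\<close>
  is this count at its end and \<open>peak\<close> the largest count reached. Carrying
  \<open>j\<close> along adds up spans that extend over several calls.\<close>

fun since :: "nat \<Rightarrow> event list \<Rightarrow> nat" where
  "since j [] = j"
| "since j (Tick # t) = since (Suc j) t"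
| "since j (Emit d # t) = since 0 t"

fun peak :: "nat \<Rightarrow> event list \<Rightarrow> nat" where
  "peak j [] = j"
| "peak j (Tick # t) = peak (Suc j) t"
| "peak j (Emit d # t) = max j (peak 0 t)"

lemma le_peak: "j \<le> peak j t"
proof (induction j t rule: peak.induct)
  case (2 j t)
  then show ?case by simp
qed auto

lemma since_le_peak: "since j t \<le> peak j t"
  by (induction j t rule: peak.induct) auto

lemma since_append: "since j (t @ t') = since (since j t) t'"
  by (induction j t rule: since.induct) auto

lemma peak_append: "peak j (t @ t') = max (peak j t) (peak (since j t) t')"
proof (induction j t rule: peak.induct)
  case (1 j)
  then show ?case using le_peak[of j t'] by (simp add: max_def)
qed (auto simp: max.assoc)

lemma since_ticks [simp]: "since j (ticks k) = j + k"
  by (induction k arbitrary: j) auto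

lemma peak_ticks [simp]: "peak j (ticks k) = j + k"
  by (induction k arbitrary: j) auto

lemma peak_add: "peak (i + j) t \<le> i + peak j t"
proof (induction j t rule: peak.induct)
  case (2 j t)
  then show ?case by simp
qed auto

lemma peak_mono: "i \<le> j \<Longrightarrow> peak i t \<le> peak j t"
proof (induction j t arbitrary: i rule: peak.induct)
  case (3 j d t)
  then show ?case by (simp add: max_def)
qed auto

lemma since_output: "outputs t \<noteq> [] \<Longrightarrow> since i t = since j t"
  by (induction i t arbitrary: j rule: since.induct) auto

lemma peak_le_if_delay: "delay_at_most (ticks j @ t) b \<Longrightarrow> peak j t \<le> b"
proof (induction j t rule: peak.induct)
  case (1 j)
  then show ?case
    unfolding delay_at_most_def by (metis append_Nil append_Nil2 peak.simps(1))
next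
  case (2 j t)
  then show ?case by (simp add: replicate_app_Cons_same)
next
  case (3 j d t)
  have "j \<le> b"
    using "3.prems" unfolding delay_at_most_def by (metis append_Nil)
  moreover have "delay_at_most t b"
    unfolding delay_at_most_def
  proof (intro allI impI)
    fix t1 k t2 assume "t = t1 @ ticks k @ t2"
    then have "ticks j @ Emit d # t = (ticks j @ Emit d # t1) @ ticks k @ t2" by simp
    then show "k \<le> b" using "3.prems" unfolding delay_at_most_def by blast
  qed
  ultimately show ?case using "3.IH" by simp
qed

text \<open>\<open>peak\<close> is the least admissible delay and, unlike the quantification over
  all factorisations, splits along \<open>@\<close>.\<close>

lemma delay_at_most_iff_peak: "delay_at_most t b \<longleftrightarrow> peak 0 t \<le> b"
proof
  show "delay_at_most t b \<Longrightarrow> peak 0 t \<le> b" using peak_le_if_delay[of 0 t b] by simp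
next
  assume b: "peak 0 t \<le> b"
  show "delay_at_most t b"
    unfolding delay_at_most_def
  proof (intro allI impI)
    fix t1 k t2 assume "t = t1 @ ticks k @ t2"
    then have "since 0 t1 + k \<le> peak 0 t" by (simp add: peak_append)
    then show "k \<le> b" using b by simp
  qed
qed

text \<open>The flag adds four ticks at the start of the span after each output; \<open>a\<close>
  stands for the added ticks already counted in the current span.\<close>

lemma peak_flagged: "a \<le> 4 \<Longrightarrow> peak (j + a) (flagged t) \<le> peak j t + 4"
proof (induction t arbitrary: j a rule: flagged.induct)
  case (2 t)
  then show ?case using "2.IH"[of a "Suc j"] by simp
next
  case (3 d t)
  have "peak 0 (ticks 4 @ flagged t) = peak 4 (flagged t)"
    using le_peak[of 4 "flagged t"] by (simp add: peak_append max_def)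
  also have "\<dots> \<le> peak 0 t + 4" using "3.IH"[of 4 0] by simp
  finally show ?case using "3.prems" by (simp add: max_def)
qed simp

text \<open>A call without output may extend the current span, but only by \<open>K\<close>. An
  output inside the call makes the count at its end independent of \<open>j\<close>.\<close>

lemma call_peak:
  fixes H K :: nat
  assumes "a \<le> H" "b \<le> H" "2 * H + peak 0 t \<le> K"
  shows "peak j (ticks a @ t @ ticks b) \<le> j + K"
    and "since j (ticks a @ t @ ticks b) \<le> j + K"
    and "outputs t \<noteq> [] \<Longrightarrow> since j (ticks a @ t @ ticks b) \<le> K"
proof -
  have "peak (j + a) t \<le> j + a + peak 0 t" using peak_add[of "j + a" 0 t] by simp
  moreover have "since (j + a) t \<le> peak (j + a) t" by (rule since_le_peak)
  ultimately show "peak j (ticks a @ t @ ticks b) \<le> j + K"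
    using assms by (simp add: peak_append)
  then show "since j (ticks a @ t @ ticks b) \<le> j + K"
    using since_le_peak le_trans by blast
  assume "outputs t \<noteq> []"
  then have "since (j + a) t \<le> peak 0 t"
    using since_output[of t "j + a" 0] since_le_peak[of 0 t] by simp
  then show "since j (ticks a @ t @ ticks b) \<le> K"
    using assms by (simp add: since_append)
qed

text \<open>
  The calls between two consecutive outputs have no output, and there are at most \<open>m + 1\<close> of them
  for every level of the tree that the search backtracks over.
\<close>

lemma walk_peak:
  assumes "walk \<tau> H p m t" "length p + m = n" "H \<le> K"
    and "\<And>b. length b = n \<Longrightarrow> 2 * H + peak 0 (flagged (\<tau> b)) \<le> K"
  shows "peak j t \<le> max (j + (m + 1) * K) ((m + 1) * (m + 2) * K)"
  using assms(1,2)
proof (induction arbitrary: j rule: walk.induct)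
  case (leaf a p)
  then show ?case using assms(3) by simp
next
  case (prune a b p m t0)
  let ?c = "ticks a @ flagged (\<tau> (p @ True # zeros m)) @ ticks b"
  have K: "2 * H + peak 0 (flagged (\<tau> (p @ True # zeros m))) \<le> K"
    using prune.prems by (intro assms(4)) simp
  note c = call_peak[OF prune.hyps(1,2) K, of j]
  have "peak (since j ?c) t0 \<le> peak (j + K) t0" using c(2) by (rule peak_mono)
  also have "\<dots> \<le> max (j + K + (m + 1) * K) ((m + 1) * (m + 2) * K)"
    using prune.prems by (intro prune.IH) simp
  also have "\<dots> \<le> max (j + (Suc m + 1) * K) ((Suc m + 1) * (Suc m + 2) * K)"
    by (intro max.mono) (simp_all add: algebra_simps)
  finally have "peak (since j ?c) t0 \<le> max (j + (Suc m + 1) * K) ((Suc m + 1) * (Suc m + 2) * K)" .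
  moreover have "peak j ?c \<le> max (j + (Suc m + 1) * K) ((Suc m + 1) * (Suc m + 2) * K)"
    using c(1) by simp
  ultimately have "peak j (?c @ t0) \<le> max (j + (Suc m + 1) * K) ((Suc m + 1) * (Suc m + 2) * K)"
    unfolding peak_append[of j ?c] by (rule max.boundedI[rotated])
  then show ?case by simp
next
  case (branch a b p m t1 t0)
  let ?c = "ticks a @ flagged (\<tau> (p @ True # zeros m)) @ ticks b"
  let ?M = "max (j + (Suc m + 1) * K) ((Suc m + 1) * (Suc m + 2) * K)"
  have K: "2 * H + peak 0 (flagged (\<tau> (p @ True # zeros m))) \<le> K"
    using branch.prems by (intro assms(4)) simp
  have "outputs (flagged (\<tau> (p @ True # zeros m))) \<noteq> []" using branch.hyps by simp
  note c = call_peak[OF branch.hyps(1,2) K, of j] call_peak(3)[OF branch.hyps(1,2) K this, of j]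
  \<comment> \<open>The output of the call resets the count, so the including subtree starts with at
    most \<open>K\<close>, whatever \<open>j\<close> was.\<close>
  have "peak (since j ?c) t1 \<le> peak K t1" using c(4) by (rule peak_mono)
  also have "\<dots> \<le> max (K + (m + 1) * K) ((m + 1) * (m + 2) * K)"
    using branch.prems by (intro branch.IH) simp
  also have "\<dots> = (m + 1) * (m + 2) * K" by (simp add: algebra_simps)
  finally have 1: "peak (since j ?c) t1 \<le> (m + 1) * (m + 2) * K" .
  then have "since (since j ?c) t1 \<le> (m + 1) * (m + 2) * K"
    using since_le_peak le_trans by blast
  \<comment> \<open>The excluding subtree may inherit the full count of its sibling and add
    \<open>(m + 1) * K\<close>. The sum \<open>(m + 1) * (m + 3) * K\<close> stays below the bound
    \<open>(m + 2) * (m + 3) * K\<close>.\<close>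
  then have "peak (since (since j ?c) t1) t0 \<le> peak ((m + 1) * (m + 2) * K) t0"
    by (rule peak_mono)
  also have "\<dots> \<le> max ((m + 1) * (m + 2) * K + (m + 1) * K) ((m + 1) * (m + 2) * K)"
    using branch.prems by (intro branch.IH) simp
  also have "\<dots> \<le> (Suc m + 1) * (Suc m + 2) * K" by (simp add: algebra_simps)
  finally have 0: "peak (since (since j ?c) t1) t0 \<le> ?M" by simp
  have "(m + 1) * (m + 2) * K \<le> (Suc m + 1) * (Suc m + 2) * K" by (simp add: algebra_simps)
  with 1 have "peak (since j ?c) t1 \<le> ?M" by linarith
  moreover have "peak j ?c \<le> ?M" using c(1) by simp
  ultimately have "peak j (?c @ t1 @ t0) \<le> ?M"
    unfolding peak_append[of j ?c] peak_append[of _ t1] using 0 by (intro max.boundedI)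
  then show ?case by simp
qed

lemma search_delay:
  assumes "search_trace \<tau> H n t" "H \<le> K"
    and K: "\<And>b. length b = n \<Longrightarrow> 2 * H + peak 0 (flagged (\<tau> b)) \<le> K"
  shows "delay_at_most t ((n + 2) * (n + 2) * K)"
proof -
  from assms obtain a b d t' where t: "t = ticks a @ flagged (\<tau> (zeros n)) @ ticks b @ t' @ ticks d"
    and H: "a \<le> H" "b \<le> H" "d \<le> H"
    and t': "if outputs (\<tau> (zeros n)) = [] then t' = [] else walk \<tau> H [] n t'"
    by (auto simp: search_trace_def)
  let ?c = "ticks a @ flagged (\<tau> (zeros n)) @ ticks b"
  have K0: "2 * H + peak 0 (flagged (\<tau> (zeros n))) \<le> K" using K by simp
  note c = call_peak[OF H(1,2) K0, of 0]
  have "peak (since 0 ?c) t' \<le> (n + 1) * (n + 2) * K"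
  proof (cases "outputs (\<tau> (zeros n)) = []")
    case True
    have "K \<le> (n + 1) * (n + 2) * K" by (simp add: algebra_simps)
    then show ?thesis using c(2) t' True by simp
  next
    case False
    have "peak (since 0 ?c) t' \<le> peak K t'" using c(2) by (intro peak_mono) simp
    also have "\<dots> \<le> max (K + (n + 1) * K) ((n + 1) * (n + 2) * K)"
      using t' False walk_peak[of \<tau> H "[]" n t' n K K] assms by simp
    also have "\<dots> = (n + 1) * (n + 2) * K" by (simp add: algebra_simps)
    finally show ?thesis .
  qed
  moreover have "since (since 0 ?c) t' \<le> peak (since 0 ?c) t'" by (rule since_le_peak)
  moreover have "peak 0 t = max (peak 0 ?c) (max (peak (since 0 ?c) t') (since (since 0 ?c) t' + d))"
    unfolding t using peak_append[of 0 ?c] peak_append[of _ t'] by simp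
  ultimately have "peak 0 t \<le> (n + 1) * (n + 2) * K + K"
    using c(1) H \<open>H \<le> K\<close> by simp
  also have "\<dots> \<le> (n + 2) * (n + 2) * K" by (simp add: algebra_simps)
  finally show ?thesis by (simp add: delay_at_most_iff_peak)
qed

section \<open>Enumeration of the minimal labellings\<close>

lemma length_le_size_enc_list: "length xs \<le> size (enc_list xs)"
  by (induction xs) auto

lemma size_enc_bits: "size (enc_bits b) \<le> 2 * length b"
  by (induction b) (auto simp: enc_bool_def)

lemma ex_set_of_bits:
  assumes "distinct vs" "length b = length vs"
  shows "\<exists>A \<subseteq> set vs. map (\<lambda>v. v \<in> A) vs = b"
proof (intro exI conjI)
  let ?A = "{vs ! i | i. i < length vs \<and> b ! i}"
  show "?A \<subseteq> set vs" by auto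
  show "map (\<lambda>v. v \<in> ?A) vs = b"
    using assms by (intro nth_equalityI) (auto simp: nth_eq_iff_index_eq)
qed

text \<open>\<open>Q\<close> relates a trace to the input size; left abstract, it serves both for
  running time and for delay.\<close>

locale minimal_enumeration = nice_property_on P G for P :: "nat property" and G +
  fixes c :: prog and k :: nat and Q :: "event list \<Rightarrow> nat \<Rightarrow> bool"
  assumes vars: "prog_vars c \<subseteq> {..<k}" "0 < k"
    and Q_mono: "\<And>t x y. Q t x \<Longrightarrow> x \<le> y \<Longrightarrow> Q t y"
    and subroutine: "\<And>A. A \<subseteq> verts G \<Longrightarrow> \<exists>t. run c (Cs (enc_graph G) (enc_set G A)) t \<and>
      distinct (outputs t) \<and> set (outputs t) = enc_labelling G ` minimal_with_twos P G A \<and>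
      Q t (size (Cs (enc_graph G) (enc_set G A)))"
begin

abbreviation "vs \<equiv> vertex_list G"

lemma vs: "set vs = verts G" "distinct vs"
  using finite_verts by (simp_all add: vertex_list_def)

lemma length_vs: "length vs \<le> size (enc_graph G)"
  unfolding enc_graph_def
  using length_le_size_enc_list[of "map (\<lambda>v. Cs (enc_nat v)
    (enc_list (map enc_nat (sorted_list_of_set (nbh G v))))) vs"] by simp

lemma enc_set_eq: "enc_set G A = enc_bits (map (\<lambda>v. v \<in> A) vs)"
  by (simp add: enc_set_def comp_def)

definition with_bits :: "bool list \<Rightarrow> (nat \<Rightarrow> nat) set" where
  "with_bits b = {f \<in> minimal_labellings P G. map (\<lambda>v. f v = 2) vs = b}"

lemma with_bits_eq:
  assumes "A \<subseteq> verts G"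
  shows "with_bits (map (\<lambda>v. v \<in> A) vs) = minimal_with_twos P G A"
  using assms vs(1) by (auto simp: with_bits_def minimal_with_twos_def level_def)

lemma with_bits_hereditary:
  assumes "length b = length vs" "list_all2 (\<le>) b' b" "with_bits b \<noteq> {}"
  shows "with_bits b' \<noteq> {}"
proof -
  have len: "length b' = length vs" using assms list_all2_lengthD by fastforce
  obtain A where A: "A \<subseteq> verts G" "map (\<lambda>v. v \<in> A) vs = b"
    using ex_set_of_bits[OF vs(2) assms(1)] vs(1) by auto
  obtain B where B: "B \<subseteq> verts G" "map (\<lambda>v. v \<in> B) vs = b'"
    using ex_set_of_bits[OF vs(2) len] vs(1) by auto
  have "list_all2 (\<le>) (map (\<lambda>v. v \<in> B) vs) (map (\<lambda>v. v \<in> A) vs)"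
    using assms(2) A B by simp
  then have "\<forall>v \<in> set vs. v \<in> B \<longrightarrow> v \<in> A"
    by (auto simp: list_all2_conv_all_nth in_set_conv_nth)
  then have "B \<subseteq> A" using B(1) vs(1) by auto
  moreover have "minimal_with_twos P G A \<noteq> {}" using assms(3) with_bits_eq[OF A(1)] A(2) by simp
  ultimately have "minimal_with_twos P G B \<noteq> {}" using minimal_with_twos_subset by blast
  then show ?thesis using with_bits_eq[OF B(1)] B(2) by simp
qed

lemma ex_traces:
  "\<exists>\<tau>. \<forall>b. length b = length vs \<longrightarrow> run c (Cs (enc_graph G) (enc_bits b)) (\<tau> b) \<and>
    distinct (outputs (\<tau> b)) \<and> set (outputs (\<tau> b)) = enc_labelling G ` with_bits b \<and>
    Q (\<tau> b) (3 * size (enc_graph G) + 1)"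
proof -
  have "\<exists>t. run c (Cs (enc_graph G) (enc_bits b)) t \<and>
    distinct (outputs t) \<and> set (outputs t) = enc_labelling G ` with_bits b \<and>
    Q t (3 * size (enc_graph G) + 1)" if b: "length b = length vs" for b
  proof -
    obtain A where A: "A \<subseteq> verts G" "map (\<lambda>v. v \<in> A) vs = b"
      using ex_set_of_bits[OF vs(2) b] vs(1) by auto
    \<comment> \<open>One cell for the pair, the graph itself, and at most two cells for the bit of
      each vertex.\<close>
    have "size (Cs (enc_graph G) (enc_bits b)) \<le> 3 * size (enc_graph G) + 1"
      using size_enc_bits[of b] length_vs b by simp
    moreover from subroutine[OF A(1)] obtain t where
      "run c (Cs (enc_graph G) (enc_bits b)) t" "distinct (outputs t)"
      "set (outputs t) = enc_labelling G ` with_bits b" "Q t (size (Cs (enc_graph G) (enc_bits b)))"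
      unfolding enc_set_eq A(2) with_bits_eq[OF A(1), symmetric] by blast
    ultimately show ?thesis using Q_mono by blast
  qed
  then show ?thesis by (intro choice) blast
qed

text \<open>The comparison of output counts allows the bound for a single call to be evaluated at
  the number of outputs of the whole search.\<close>

lemma search_correct:
  assumes "H = 2 * k + 10 * size (enc_graph G) + 40"
  shows "\<exists>t \<tau>. run (search k c) (enc_graph G) t \<and> search_trace \<tau> H (length vs) t \<and>
    distinct (outputs t) \<and> set (outputs t) = enc_labelling G ` minimal_labellings P G \<and>
    (\<forall>b. length b = length vs \<longrightarrow> Q (\<tau> b) (3 * size (enc_graph G) + 1) \<and>
      length (outputs (\<tau> b)) \<le> length (outputs t))"
proof -
  obtain \<tau> where \<tau>: "\<And>b. length b = length vs \<Longrightarrow> run c (Cs (enc_graph G) (enc_bits b)) (\<tau> b)"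
    "\<And>b. length b = length vs \<Longrightarrow> distinct (outputs (\<tau> b))"
    "\<And>b. length b = length vs \<Longrightarrow> set (outputs (\<tau> b)) = enc_labelling G ` with_bits b"
    "\<And>b. length b = length vs \<Longrightarrow> Q (\<tau> b) (3 * size (enc_graph G) + 1)"
    using ex_traces by blast
  interpret subroutine_traces \<tau> "length vs"
  proof
    fix b b' :: "bool list" assume b: "length b = length vs" and le: "list_all2 (\<le>) b' b" and "outputs (\<tau> b') = []"
    moreover have "length b' = length vs" using b le list_all2_lengthD by fastforce
    ultimately have "with_bits b' = {}" using \<tau>(3)[of b'] by simp
    then have "with_bits b = {}" using with_bits_hereditary[OF b le] by blast
    then show "outputs (\<tau> b) = []" using \<tau>(3)[OF b] by simp
  next
    fix b b' :: "bool list" assume b: "length b = length vs" "length b' = length vs" "b \<noteq> b'"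
    have "with_bits b \<inter> with_bits b' = {}" using b(3) by (auto simp: with_bits_def)
    \<comment> \<open>The encoding is injective on labellings, so disjointness passes to the images
      once both sets are known to lie there.\<close>
    moreover have "with_bits b \<subseteq> labellings G" "with_bits b' \<subseteq> labellings G"
      using minimal_in_labellings by (auto simp: with_bits_def)
    ultimately have "enc_labelling G ` with_bits b \<inter> enc_labelling G ` with_bits b' = {}"
      using inj_on_image_Int[OF inj_on_enc_labelling[OF simple], of "with_bits b" "with_bits b'"]
      by simp
    then show "set (outputs (\<tau> b)) \<inter> set (outputs (\<tau> b')) = {}" using \<tau>(3) b by simp
  qed (rule \<tau>(2))
  define xs where
    "xs = map (\<lambda>v. Cs (enc_nat v) (enc_list (map enc_nat (sorted_list_of_set (nbh G v))))) vs"
  have xs: "enc_list xs = enc_graph G" "length xs = length vs"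
    by (simp_all add: xs_def enc_graph_def)
  have "2 * k + 10 * length xs + 40 \<le> H" using assms length_vs xs by simp
  from run_search[OF vars _ this, of \<tau>] \<tau>(1) obtain t where
    t: "run (search k c) (enc_graph G) t" "search_trace \<tau> H (length vs) t"
    unfolding xs by blast
  have "outs {b. length b = length vs} = enc_labelling G ` minimal_labellings P G"
  proof -
    have "minimal_labellings P G = (\<Union>b \<in> {b. length b = length vs}. with_bits b)"
      by (auto simp: with_bits_def)
    then show ?thesis using \<tau>(3) by (auto simp: outs_def)
  qed
  with search_outputs[OF t(2)] have
    out: "distinct (outputs t)" "set (outputs t) = enc_labelling G ` minimal_labellings P G" by auto
  have "length (outputs (\<tau> b)) \<le> length (outputs t)" if b: "length b = length vs" for b
  proof -
    have "set (outputs (\<tau> b)) \<subseteq> set (outputs t)"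
      using \<tau>(3)[OF b] out(2) by (auto simp: with_bits_def)
    then have "card (set (outputs (\<tau> b))) \<le> card (set (outputs t))" by (intro card_mono) auto
    then show ?thesis using \<tau>(2)[OF b] out(1) by (simp add: distinct_card)
  qed
  then show ?thesis using t out \<tau>(4) by blast
qed

end

section \<open>Polynomial bounds\<close>

lemma poly_nat_mono: "x \<le> y \<Longrightarrow> poly p x \<le> poly p (y :: nat)"
  by (induction p) (simp_all add: add_le_mono mult_le_mono)

lemma poly_poly_nat_mono:
  fixes p :: "nat poly poly"
  assumes "m \<le> m'" "x \<le> x'"
  shows "poly (poly p [:m:]) x \<le> poly (poly p [:m':]) x'"
proof (induction p)
  case 0
  show ?case by simp
next
  case (pCons a p)
  have "poly a x + m * poly (poly p [:m:]) x \<le> poly a x' + m' * poly (poly p [:m':]) x'"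
    by (intro add_le_mono mult_le_mono poly_nat_mono assms pCons.IH)
  then show ?case by simp
qed

text \<open>The size variable lives in the coefficients, so substituting for it means composing each
  coefficient with \<open>r\<close>.\<close>

lemma ex_poly_poly_pcompose:
  fixes p :: "nat poly poly"
  shows "\<exists>q. \<forall>m x. poly (poly q [:m:]) x = poly (poly p [:m:]) (poly r x)"
proof (induction p)
  case 0
  show ?case by (intro exI[of _ 0]) simp
next
  case (pCons a p)
  then obtain q where "\<forall>m x. poly (poly q [:m:]) x = poly (poly p [:m:]) (poly r x)" by blast
  then show ?case by (intro exI[of _ "pCons (pcompose a r) q"]) (simp add: poly_pcompose)
qed

lemma ex_var_bound: "\<exists>k. prog_vars c \<subseteq> {..<k} \<and> 0 < k"
proof -
  obtain k where "\<forall>x \<in> prog_vars c. x < k"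
    using finite_prog_vars finite_nat_set_iff_bounded by blast
  then have "prog_vars c \<subseteq> {..<Suc k} \<and> 0 < Suc k" by (auto simp: less_Suc_eq)
  then show ?thesis by blast
qed

lemma output_poly_search:
  fixes P :: "nat property"
  assumes P: "labelling_property P" "nice_roman_property P"
    and \<G>: "\<And>G. G \<in> \<G> \<Longrightarrow> simple_graph G"
    and c: "enumerates_output_poly c {(G, A). G \<in> \<G> \<and> A \<subseteq> verts G}
      (\<lambda>(G, A). Cs (enc_graph G) (enc_set G A))
      (\<lambda>(G, A). enc_labelling G ` minimal_with_twos P G A)"
    and vars: "prog_vars c \<subseteq> {..<k}" "0 < k"
  shows "enumerates_output_poly (search k c) \<G> enc_graph
    (\<lambda>G. enc_labelling G ` minimal_labellings P G)"
proof -
  from c obtain p :: "nat poly poly" where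
    p: "\<forall>G A. G \<in> \<G> \<and> A \<subseteq> verts G \<longrightarrow> (\<exists>t. run c (Cs (enc_graph G) (enc_set G A)) t \<and>
      distinct (outputs t) \<and> set (outputs t) = enc_labelling G ` minimal_with_twos P G A \<and>
      run_time t \<le> poly (poly p [:length (outputs t):]) (size (Cs (enc_graph G) (enc_set G A))))"
    unfolding enumerates_output_poly_def by (auto simp del: sexp.size)
  obtain q where q: "\<And>m x. poly (poly q [:m:]) x = poly (poly p [:m:]) (3 * x + 1)"
    using ex_poly_poly_pcompose[of p "[:1, 3:]"] by (auto simp: mult.commute)
  \<comment> \<open>In terms of the graph size \<open>x\<close>, \<open>h\<close> is the overhead
    \<open>H\<close>. \<open>K\<close> adds twice \<open>h\<close>, the time of a call on an input
    of size at most \<open>3 * x + 1\<close>, and 4 ticks per output for the flag. \<open>r\<close>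
    is the bound of \<open>search_run_time\<close> with \<open>x\<close> for the number of
    vertices.\<close>
  define h :: "nat poly" where "h = [:2 * k + 40, 10:]"
  define K where "K = [:[:2:] * h:] + q + [:0, [:4:]:]"
  define r where "r = [:[:3, 1:]:] * K * [:1, 1:]"
  have K: "poly (poly K [:m:]) x = 2 * (2 * k + 10 * x + 40) +
      poly (poly p [:m:]) (3 * x + 1) + 4 * m" for m x
    by (simp add: K_def h_def q)
  have r: "poly (poly r [:m:]) x = (x + 3) * (2 * (2 * k + 10 * x + 40) +
      poly (poly p [:m:]) (3 * x + 1) + 4 * m) * (m + 1)" for m x
    unfolding r_def poly_mult K by (simp add: add.commute[of 3])
  have "\<exists>t. run (search k c) (enc_graph G) t \<and> distinct (outputs t) \<and>
      set (outputs t) = enc_labelling G ` minimal_labellings P G \<and>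
      run_time t \<le> poly (poly r [:length (outputs t):]) (size (enc_graph G))" if G: "G \<in> \<G>" for G
  proof -
    interpret minimal_enumeration P G c k "\<lambda>t x. run_time t \<le> poly (poly p [:length (outputs t):]) x"
    proof
      fix t :: "event list" and x y :: nat
      assume "run_time t \<le> poly (poly p [:length (outputs t):]) x" "x \<le> y"
      then show "run_time t \<le> poly (poly p [:length (outputs t):]) y"
        using poly_nat_mono le_trans by blast
    qed (fact P \<G>[OF G] vars p[rule_format, OF conjI[OF G]])+
    let ?x = "size (enc_graph G)"
    define H where "H = 2 * k + 10 * ?x + 40"
    obtain t \<tau> where t: "run (search k c) (enc_graph G) t" "search_trace \<tau> H (length vs) t"
      "distinct (outputs t)" "set (outputs t) = enc_labelling G ` minimal_labellings P G"
      and \<tau>: "\<And>b. length b = length vs \<Longrightarrow>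
        run_time (\<tau> b) \<le> poly (poly p [:length (outputs (\<tau> b)):]) (3 * ?x + 1) \<and>
        length (outputs (\<tau> b)) \<le> length (outputs t)"
      using search_correct[OF H_def] by blast
    let ?N = "length (outputs t)"
    define L where "L = 2 * H + poly (poly p [:?N:]) (3 * ?x + 1) + 4 * ?N"
    have "2 * H + run_time (flagged (\<tau> b)) \<le> L" if "length b = length vs" for b
    proof -
      have "poly (poly p [:length (outputs (\<tau> b)):]) (3 * ?x + 1) \<le> poly (poly p [:?N:]) (3 * ?x + 1)"
        using \<tau>[OF that] by (intro poly_poly_nat_mono) auto
      then show ?thesis using \<tau>[OF that] by (simp add: L_def run_time_flagged)
    qed
    then have "run_time t \<le> (length vs + 3) * L * (?N + 1)"
      by (intro search_run_time[OF t(2)]) (simp_all add: L_def)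
    also have "\<dots> \<le> (?x + 3) * L * (?N + 1)"
      using length_vs by (intro mult_le_mono) auto
    also have "\<dots> = poly (poly r [:?N:]) ?x" by (simp add: r L_def H_def)
    finally show ?thesis using t by blast
  qed
  then show ?thesis unfolding enumerates_output_poly_def by blast
qed

lemma poly_delay_search:
  fixes P :: "nat property"
  assumes P: "labelling_property P" "nice_roman_property P"
    and \<G>: "\<And>G. G \<in> \<G> \<Longrightarrow> simple_graph G"
    and c: "enumerates_poly_delay c {(G, A). G \<in> \<G> \<and> A \<subseteq> verts G}
      (\<lambda>(G, A). Cs (enc_graph G) (enc_set G A))
      (\<lambda>(G, A). enc_labelling G ` minimal_with_twos P G A)"
    and vars: "prog_vars c \<subseteq> {..<k}" "0 < k"
  shows "enumerates_poly_delay (search k c) \<G> enc_graph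
    (\<lambda>G. enc_labelling G ` minimal_labellings P G)"
proof -
  from c obtain p :: "nat poly" where
    p: "\<forall>G A. G \<in> \<G> \<and> A \<subseteq> verts G \<longrightarrow> (\<exists>t. run c (Cs (enc_graph G) (enc_set G A)) t \<and>
      distinct (outputs t) \<and> set (outputs t) = enc_labelling G ` minimal_with_twos P G A \<and>
      delay_at_most t (poly p (size (Cs (enc_graph G) (enc_set G A)))))"
    unfolding enumerates_poly_delay_def by (auto simp del: sexp.size)
  \<comment> \<open>The flag contributes 4 in all, and not 4 per output, because it lengthens each
    span at most by that much.\<close>
  define K where "K = [:2:] * [:2 * k + 40, 10:] + pcompose p [:1, 3:] + [:4:]"
  define r where "r = [:2, 1:] * [:2, 1:] * K"
  have K: "poly K x = 2 * (2 * k + 10 * x + 40) + poly p (3 * x + 1) + 4" for x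
    by (simp add: K_def poly_pcompose mult.commute)
  have r: "poly r x = (x + 2) * (x + 2) * (2 * (2 * k + 10 * x + 40) + poly p (3 * x + 1) + 4)" for x
    unfolding r_def poly_mult K by simp
  have "\<exists>t. run (search k c) (enc_graph G) t \<and> distinct (outputs t) \<and>
      set (outputs t) = enc_labelling G ` minimal_labellings P G \<and>
      delay_at_most t (poly r (size (enc_graph G)))" if G: "G \<in> \<G>" for G
  proof -
    interpret minimal_enumeration P G c k "\<lambda>t x. delay_at_most t (poly p x)"
    proof
      fix t :: "event list" and x y :: nat
      assume "delay_at_most t (poly p x)" "x \<le> y"
      then show "delay_at_most t (poly p y)"
        unfolding delay_at_most_iff_peak using poly_nat_mono le_trans by blast
    qed (fact P \<G>[OF G] vars p[rule_format, OF conjI[OF G]])+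
    let ?x = "size (enc_graph G)"
    define H where "H = 2 * k + 10 * ?x + 40"
    obtain t \<tau> where t: "run (search k c) (enc_graph G) t" "search_trace \<tau> H (length vs) t"
      "distinct (outputs t)" "set (outputs t) = enc_labelling G ` minimal_labellings P G"
      and \<tau>: "\<And>b. length b = length vs \<Longrightarrow> delay_at_most (\<tau> b) (poly p (3 * ?x + 1))"
      using search_correct[OF H_def] by blast
    define L where "L = 2 * H + poly p (3 * ?x + 1) + 4"
    have "2 * H + peak 0 (flagged (\<tau> b)) \<le> L" if "length b = length vs" for b
      using \<tau>[OF that] peak_flagged[of 0 0 "\<tau> b"] by (simp add: delay_at_most_iff_peak L_def)
    then have "delay_at_most t ((length vs + 2) * (length vs + 2) * L)"
      by (intro search_delay[OF t(2)]) (simp_all add: L_def)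
    moreover have "(length vs + 2) * (length vs + 2) * L \<le> (?x + 2) * (?x + 2) * L"
      using length_vs by (intro mult_le_mono) auto
    moreover have "(?x + 2) * (?x + 2) * L = poly r ?x" by (simp add: r L_def H_def)
    ultimately have "delay_at_most t (poly r ?x)" unfolding delay_at_most_iff_peak by linarith
    then show ?thesis using t by blast
  qed
  then show ?thesis unfolding enumerates_poly_delay_def by blast
qed

theorem theorem1:
  fixes P :: "nat property" and \<G> :: "nat ugraph set"
  assumes "labelling_property P"
    and "nice_roman_property P"
    and "\<And>G. G \<in> \<G> \<Longrightarrow> simple_graph G"
  shows "((\<exists>c. enumerates_output_poly c
              {(G, A). G \<in> \<G> \<and> A \<subseteq> verts G}
              (\<lambda>(G, A). Cs (enc_graph G) (enc_set G A))
              (\<lambda>(G, A). enc_labelling G ` minimal_with_twos P G A))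
          \<longrightarrow> (\<exists>c. enumerates_output_poly c \<G> enc_graph
                (\<lambda>G. enc_labelling G ` minimal_labellings P G)))
       \<and> ((\<exists>c. enumerates_poly_delay c
              {(G, A). G \<in> \<G> \<and> A \<subseteq> verts G}
              (\<lambda>(G, A). Cs (enc_graph G) (enc_set G A))
              (\<lambda>(G, A). enc_labelling G ` minimal_with_twos P G A))
          \<longrightarrow> (\<exists>c. enumerates_poly_delay c \<G> enc_graph
                (\<lambda>G. enc_labelling G ` minimal_labellings P G)))"
proof (intro conjI impI; elim exE)
  fix c assume c: "enumerates_output_poly c {(G, A). G \<in> \<G> \<and> A \<subseteq> verts G}
    (\<lambda>(G, A). Cs (enc_graph G) (enc_set G A)) (\<lambda>(G, A). enc_labelling G ` minimal_with_twos P G A)"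
  \<comment> \<open>The registers from \<open>k\<close> on must be free for the search, and register
    0 must remain the input.\<close>
  obtain k where "prog_vars c \<subseteq> {..<k}" "0 < k" using ex_var_bound by blast
  from output_poly_search[OF assms c this]
  show "\<exists>c. enumerates_output_poly c \<G> enc_graph (\<lambda>G. enc_labelling G ` minimal_labellings P G)" ..
next
  fix c assume c: "enumerates_poly_delay c {(G, A). G \<in> \<G> \<and> A \<subseteq> verts G}
    (\<lambda>(G, A). Cs (enc_graph G) (enc_set G A)) (\<lambda>(G, A). enc_labelling G ` minimal_with_twos P G A)"
  obtain k where "prog_vars c \<subseteq> {..<k}" "0 < k" using ex_var_bound by blast
  from poly_delay_search[OF assms c this]
  show "\<exists>c. enumerates_poly_delay c \<G> enc_graph (\<lambda>G. enc_labelling G ` minimal_labellings P G)" ..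
qed

end
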